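(* Let $\mathcal{C}_W$ be the category described in the context, let $p:\widehat{\mathcal{C}_W}\to\mathbf{Set}$ be the canonical geometric morphism from the topos of presheaves on $\mathcal{C}_W$, and let $\pi_0=p^*p_!:\widehat{\mathcal{C}_W}\to\widehat{\mathcal{C}_W}$, where $p_!$ is the left adjoint of $p^*$ (the colimit functor). Let $R$ be the presheaf represented by $\mathrm{Spec}(C^\infty(\mathbb{R}))$, a ring object. Let $U\rightarrowtail R$ be the subobject of invertible elements, let $U_+\rightarrowtail U$ be the kernel of the group morphism $U\to\pi_0 U$ (i.e. the pullback of $\pi_0(1):\pi_0\mathbf{1}\to\pi_0 U$ along the unit $U\to\pi_0U$, where $1:\mathbf{1}\to U$ is the unit of $R$). Define, in the internal language, $A=\{a\in R\mid a+U_+\subseteq U_+\}$ and $M=\{\lambda\in R\mid \lambda A\subseteq A\}$. Let $H\rightarrowtail R$ be the monomorphism (between representables) induced by the quotient $C^\infty(\mathbb{R})\to C^\infty[0,\infty)$. Then, in $\widehat{\mathcal{C}_W}$, the subobjects $M\rightarrowtail R$ and $H\rightarrowtail R$ coincide.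
   Context: A $C^\infty$-ring is a model of the algebraic theory whose $n$-ary operations (for each finite $n$) are the smooth functions $\mathbb{R}^n\to\mathbb{R}$; $C^\infty$-rings and their homomorphisms form the category $C^\infty\text{-}\mathbf{Ring}$. For a manifold $N$, $C^\infty(N)$ denotes the $C^\infty$-ring of smooth real functions on $N$. $\mathrm{Aff}_{C^\infty}$ is the opposite of the category of finitely generated $C^\infty$-rings; a finitely generated $C^\infty$-ring $A$ viewed as an object of it is written $\mathrm{Spec}\,A$. This category is extensive; an object is connected if it has exactly two complemented subobjects (equivalently the $C^\infty$-ring has exactly two idempotents), and a point of $\mathrm{Spec}\,A$ is a map from the terminal object $\mathrm{Spec}\,\mathbb{R}$, i.e. a $C^\infty$-ring homomorphism $A\to\mathbb{R}$. $\mathcal{C}$ is the (essentially small) full subcategory of $\mathrm{Aff}_{C^\infty}$ of connected objects that have a point. A Weil algebra is a finite-dimensional commutative $\mathbb{R}$-algebra of the form $\mathbb{R}\oplus N$ with $N$ a nilpotent ideal; it carries a canonical $C^\infty$-ring structure. A $C^\infty$-ring $A$ is W-determined if the family of all $C^\infty$-ring homomorphisms $A\to W$ with $W$ a Weil algebra is jointly monic. $\mathcal{C}_W$ is the full subcategory of $\mathcal{C}$ on the objects $\mathrm{Spec}\,A$ with $A$ W-determined. $C^\infty[0,\infty)=C^\infty(\mathbb{R})/I$, where $I$ is the ideal of smooth functions $\mathbb{R}\to\mathbb{R}$ vanishing on $[0,\infty)$; it is W-determined and $H=\mathrm{Spec}(C^\infty[0,\infty))$ is an object of $\mathcal{C}_W$.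 *)

theory Defs
  imports "HOL-Analysis.Analysis"
begin

text \<open>A function of n real variables is represented as a function on nat => real
that depends only on the first n coordinates.\<close>

definition depends_on :: "nat \<Rightarrow> ((nat \<Rightarrow> real) \<Rightarrow> real) \<Rightarrow> bool" where
  "depends_on n f \<longleftrightarrow> (\<forall>x y. (\<forall>i<n. x i = y i) \<longrightarrow> f x = f y)"

definition cont_n :: "nat \<Rightarrow> ((nat \<Rightarrow> real) \<Rightarrow> real) \<Rightarrow> bool" where
  "cont_n n f \<longleftrightarrow> (\<forall>x. \<forall>e>0. \<exists>d>0. \<forall>y. (\<forall>i<n. \<bar>y i - x i\<bar> < d) \<longrightarrow> \<bar>f y - f x\<bar> < e)"

coinductive_set smooth_fun :: "nat \<Rightarrow> ((nat \<Rightarrow> real) \<Rightarrow> real) set" for n :: nat where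
  "\<lbrakk> depends_on n f; cont_n n f;
     \<forall>i. i < n \<longrightarrow> (\<exists>g. g \<in> smooth_fun n \<and> (\<forall>x. ((\<lambda>t. f (x(i := t))) has_real_derivative g x) (at (x i)))) \<rbrakk>
   \<Longrightarrow> f \<in> smooth_fun n"

text \<open>A C-infinity ring on carrier S: op n f xs interprets the smooth function f of n
variables at the arguments xs 0, ..., xs (n-1).\<close>
type_synonym 'c cinf = "'c set \<times> (nat \<Rightarrow> ((nat \<Rightarrow> real) \<Rightarrow> real) \<Rightarrow> (nat \<Rightarrow> 'c) \<Rightarrow> 'c)"

definition cinf_ring :: "'c cinf \<Rightarrow> bool" where
  "cinf_ring A \<longleftrightarrow> (case A of (S, op) \<Rightarrow>
     (\<forall>n f xs. f \<in> smooth_fun n \<and> (\<forall>i<n. xs i \<in> S) \<longrightarrow> op n f xs \<in> S) \<and>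
     (\<forall>n f xs ys. f \<in> smooth_fun n \<and> (\<forall>i<n. xs i = ys i) \<longrightarrow> op n f xs = op n f ys) \<and>
     (\<forall>n i xs. i < n \<and> (\<forall>j<n. xs j \<in> S) \<longrightarrow> op n (\<lambda>y. y i) xs = xs i) \<and>
     (\<forall>n m f g xs. f \<in> smooth_fun n \<and> (\<forall>j<n. g j \<in> smooth_fun m) \<and> (\<forall>i<m. xs i \<in> S) \<longrightarrow>
        op m (\<lambda>y. f (\<lambda>j. g j y)) xs = op n f (\<lambda>j. op m (g j) xs)))"

definition carrier_of :: "'c cinf \<Rightarrow> 'c set" where "carrier_of A = fst A"
definition op_of :: "'c cinf \<Rightarrow> nat \<Rightarrow> ((nat \<Rightarrow> real) \<Rightarrow> real) \<Rightarrow> (nat \<Rightarrow> 'c) \<Rightarrow> 'c"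
  where "op_of A = snd A"

definition czero :: "'c cinf \<Rightarrow> 'c" where "czero A = op_of A 0 (\<lambda>_. 0) (\<lambda>_. undefined)"
definition cone :: "'c cinf \<Rightarrow> 'c" where "cone A = op_of A 0 (\<lambda>_. 1) (\<lambda>_. undefined)"
definition cscal :: "'c cinf \<Rightarrow> real \<Rightarrow> 'c" where "cscal A c = op_of A 0 (\<lambda>_. c) (\<lambda>_. undefined)"
definition cadd :: "'c cinf \<Rightarrow> 'c \<Rightarrow> 'c \<Rightarrow> 'c" where
  "cadd A x y = op_of A 2 (\<lambda>v. v 0 + v 1) (\<lambda>i. if i = 0 then x else y)"
definition cmul :: "'c cinf \<Rightarrow> 'c \<Rightarrow> 'c \<Rightarrow> 'c" where
  "cmul A x y = op_of A 2 (\<lambda>v. v 0 * v 1) (\<lambda>i. if i = 0 then x else y)"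

definition cunits :: "'c cinf \<Rightarrow> 'c set" where
  "cunits A = {x \<in> carrier_of A. \<exists>y\<in>carrier_of A. cmul A x y = cone A}"

definition cidempotents :: "'c cinf \<Rightarrow> 'c set" where
  "cidempotents A = {x \<in> carrier_of A. cmul A x x = x}"

definition cinf_hom :: "'c cinf \<Rightarrow> 'd cinf \<Rightarrow> ('c \<Rightarrow> 'd) \<Rightarrow> bool" where
  "cinf_hom A B h \<longleftrightarrow> (\<forall>x\<in>carrier_of A. h x \<in> carrier_of B) \<and>
     (\<forall>n f xs. f \<in> smooth_fun n \<and> (\<forall>i<n. xs i \<in> carrier_of A) \<longrightarrow>
        h (op_of A n f xs) = op_of B n f (h \<circ> xs))"

definition real_cinf :: "real cinf" where "real_cinf = (UNIV, \<lambda>n f xs. f xs)"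

definition finitely_generated :: "'c cinf \<Rightarrow> bool" where
  "finitely_generated A \<longleftrightarrow> (\<exists>n g. (\<forall>i<n. g i \<in> carrier_of A) \<and>
     (\<forall>x\<in>carrier_of A. \<exists>f\<in>smooth_fun n. x = op_of A n f g))"

text \<open>Weil algebras: C-infinity rings whose underlying R-algebra is finite dimensional and of
the form R + N with N a nilpotent ideal.  (The C-infinity structure on such an algebra is
unique, hence it is the canonical one.)  Carriers are taken in the type nat => real, which
has the cardinality of the continuum, so every Weil algebra has an isomorphic copy here.\<close>
definition weil_algebra :: "'c cinf \<Rightarrow> bool" where
  "weil_algebra W \<longleftrightarrow> cinf_ring W \<and>
     (\<exists>k e. (\<forall>i<k. e i \<in> carrier_of W) \<and>
        (\<forall>w\<in>carrier_of W. \<exists>c. w = op_of W k (\<lambda>y. \<Sum>i<k. c i * y i) e)) \<and>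
     (\<exists>N. N \<subseteq> carrier_of W \<and> czero W \<in> N \<and>
        (\<forall>x\<in>N. \<forall>y\<in>N. cadd W x y \<in> N) \<and>
        (\<forall>x\<in>N. \<forall>w\<in>carrier_of W. cmul W w x \<in> N) \<and>
        (\<exists>k>0. \<forall>xs. (\<forall>i<k. xs i \<in> N) \<longrightarrow> op_of W k (\<lambda>y. \<Prod>i<k. y i) xs = czero W) \<and>
        (\<forall>w\<in>carrier_of W. \<exists>!(c, n). n \<in> N \<and> w = cadd W (cscal W c) n))"

definition W_determined :: "'c cinf \<Rightarrow> bool" where
  "W_determined A \<longleftrightarrow> (\<forall>x\<in>carrier_of A. \<forall>y\<in>carrier_of A.
     (\<forall>(W :: (nat \<Rightarrow> real) cinf) h. weil_algebra W \<and> cinf_hom A W h \<longrightarrow> h x = h y) \<longrightarrow> x = y)"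

text \<open>Objects of C_W (up to isomorphism): finitely generated, W-determined C-infinity rings
with exactly two idempotents and a point (a homomorphism to R).  Every finitely generated
C-infinity ring has cardinality at most continuum, so it has an isomorphic copy with carrier
in nat => real.  A morphism Spec B -> Spec A is a homomorphism A -> B.\<close>
type_synonym obj = "(nat \<Rightarrow> real) cinf"

definition CW_obj :: "obj \<Rightarrow> bool" where
  "CW_obj A \<longleftrightarrow> cinf_ring A \<and> finitely_generated A \<and> W_determined A \<and>
     card (cidempotents A) = 2 \<and> (\<exists>h. cinf_hom A real_cinf h)"

definition CW_hom :: "obj \<Rightarrow> obj \<Rightarrow> ((nat \<Rightarrow> real) \<Rightarrow> (nat \<Rightarrow> real)) \<Rightarrow> bool" where
  "CW_hom A B h \<longleftrightarrow> CW_obj A \<and> CW_obj B \<and> cinf_hom A B h"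

text \<open>The presheaf R sends Spec A to the carrier of A; U to the units of A.
pi_0 U = colimit of U = connected components of its category of elements: the equivalence
relation generated by (A, u) ~ (B, h u) for morphisms h : A -> B.\<close>
inductive pi0_eq :: "obj \<times> (nat \<Rightarrow> real) \<Rightarrow> obj \<times> (nat \<Rightarrow> real) \<Rightarrow> bool" where
  pi0_refl: "CW_obj A \<Longrightarrow> u \<in> cunits A \<Longrightarrow> pi0_eq (A, u) (A, u)"
| pi0_step: "CW_hom A B h \<Longrightarrow> u \<in> cunits A \<Longrightarrow> pi0_eq (A, u) (B, h u)"
| pi0_sym: "pi0_eq p q \<Longrightarrow> pi0_eq q p"
| pi0_trans: "pi0_eq p q \<Longrightarrow> pi0_eq q r \<Longrightarrow> pi0_eq p r"

definition Uplus :: "obj \<Rightarrow> (nat \<Rightarrow> real) set" where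
  "Uplus A = {u \<in> cunits A. pi0_eq (A, u) (A, cone A)}"

text \<open>Kripke-Joyal interpretation of A = {a in R | a + U_+ subset U_+}.\<close>
definition Aset :: "obj \<Rightarrow> (nat \<Rightarrow> real) set" where
  "Aset A = {a \<in> carrier_of A. \<forall>B h. CW_hom A B h \<longrightarrow>
              (\<forall>u\<in>Uplus B. cadd B (h a) u \<in> Uplus B)}"

text \<open>Kripke-Joyal interpretation of M = {lambda in R | lambda A subset A}.\<close>
definition Mset :: "obj \<Rightarrow> (nat \<Rightarrow> real) set" where
  "Mset A = {l \<in> carrier_of A. \<forall>B h. CW_hom A B h \<longrightarrow>
              (\<forall>a\<in>Aset B. cmul B (h l) a \<in> Aset B)}"

text \<open>H(A) = Hom(C^infty[0,inf), A) as a subset of Hom(C^infty(R), A) = A: elements x such that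
the homomorphism C^infty(R) -> A, f |-> f(x), kills every f vanishing on [0,inf).\<close>
definition Hset :: "obj \<Rightarrow> (nat \<Rightarrow> real) set" where
  "Hset A = {x \<in> carrier_of A. \<forall>f\<in>smooth_fun 1. (\<forall>t. t 0 \<ge> 0 \<longrightarrow> f t = 0) \<longrightarrow>
              op_of A 1 f (\<lambda>_. x) = czero A}"

end

theory Submission
  imports Defs
begin

text \<open>
A unit \<open>u\<close> with inverse \<open>v\<close> satisfies \<open>(u + v)\<^sup>2 = r\<^sup>2\<close> for \<open>r = sqrt ((u - v)\<^sup>2 + 4)\<close>, so
\<open>(1 + (u + v) / r) / 2\<close> is idempotent. Over a connected ring it is \<open>0\<close> or \<open>1\<close>, which makes
\<open>u\<close> or \<open>- u\<close> equal to a positive smooth function of \<open>u - v\<close>, hence an exponential. Since all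
exponentials are pulled back from the single element \<open>exp\<close> of \<open>C\<^sup>\<infinity>(\<real>)\<close>, which also pulls back
to \<open>1\<close>, the object \<open>U\<^sub>+\<close> consists exactly of the exponentials.

If \<open>\<lambda> \<in> M\<close>, then \<open>\<lambda> \<in> A\<close> because \<open>1 \<in> A\<close>, so \<open>\<lambda> + r\<close> is an exponential for every real
\<open>r > 0\<close>. In a Weil algebra \<open>\<lambda>\<close> becomes \<open>c + n\<close> with \<open>n\<close> nilpotent. If \<open>c \<ge> 0\<close>, then every \<open>f\<close>
vanishing on the half-line satisfies \<open>f (c + t) = t\<^sup>k g(t)\<close> with \<open>g\<close> smooth, and \<open>f (c + n) = 0\<close>.
If \<open>c < 0\<close>, then \<open>n = \<lambda> - c\<close> is an exponential, so the Weil algebra is trivial.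

Conversely let \<open>y \<in> H\<close>, \<open>a \<in> A\<close> and \<open>u = exp t\<close>. With \<open>\<epsilon> = exp t / (2 (1 + a\<^sup>2))\<close> one has
\<open>y a + u = (y + \<epsilon>) a + \<delta>\<close>, where \<open>\<delta> = u - \<epsilon> a\<close> is a positive function of \<open>a\<close> and \<open>t\<close>. The element
\<open>y + \<epsilon>\<close> agrees with a positive function \<open>D\<close> of \<open>y, a, t\<close>, obtained by adding a multiple of the
flat function of \<open>y\<close> that is \<open>exp (1 / y)\<close> for \<open>y < 0\<close>. Hence \<open>y a + u = D (a + \<delta> / D)\<close> is a
product of two elements of \<open>U\<^sub>+\<close>.
\<close>

section \<open>Smooth functions\<close>

definition partial_deriv :: "nat \<Rightarrow> ((nat \<Rightarrow> real) \<Rightarrow> real) \<Rightarrow> ((nat \<Rightarrow> real) \<Rightarrow> real) \<Rightarrow> bool" where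
  "partial_deriv i f g \<longleftrightarrow> (\<forall>x. ((\<lambda>t. f (x(i := t))) has_real_derivative g x) (at (x i)))"

text \<open>The filter form of the condition in \<open>cont_n\<close>: closeness is demanded in the
  first \<open>n\<close> coordinates only, so the limit rules for filters apply directly.\<close>

definition coord_nhds :: "nat \<Rightarrow> (nat \<Rightarrow> real) \<Rightarrow> (nat \<Rightarrow> real) filter" where
  "coord_nhds n x = (INF e\<in>{0<..}. principal {y. \<forall>i<n. \<bar>y i - x i\<bar> < e})"

lemma eventually_coord_nhds:
  "eventually P (coord_nhds n x) \<longleftrightarrow> (\<exists>d>0. \<forall>y. (\<forall>i<n. \<bar>y i - x i\<bar> < d) \<longrightarrow> P y)"
proof -
  have "eventually P (coord_nhds n x) \<longleftrightarrow>
      (\<exists>b\<in>{0<..}. eventually P (principal {y. \<forall>i<n. \<bar>y i - x i\<bar> < b}))"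
    unfolding coord_nhds_def
  proof (rule eventually_INF_base)
    fix a b :: real assume "a \<in> {0<..}" "b \<in> {0<..}"
    then show "\<exists>c\<in>{0<..}. principal {y. \<forall>i<n. \<bar>y i - x i\<bar> < c} \<le>
        inf (principal {y. \<forall>i<n. \<bar>y i - x i\<bar> < a}) (principal {y. \<forall>i<n. \<bar>y i - x i\<bar> < b})"
      by (intro bexI[of _ "min a b"]) auto
  qed (auto intro: exI[of _ 1])
  then show ?thesis by (auto simp: eventually_principal)
qed

lemma cont_n_iff: "cont_n n f \<longleftrightarrow> (\<forall>x. (f \<longlongrightarrow> f x) (coord_nhds n x))"
  unfolding cont_n_def tendsto_iff eventually_coord_nhds dist_real_def by blast

text \<open>Finitely many coordinate bounds hold eventually together. With this, continuity of a
  composite becomes composition of limits.\<close>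

lemma tendsto_coord_nhds_iff:
  "filterlim g (coord_nhds m y) F \<longleftrightarrow> (\<forall>j<m. ((\<lambda>z. g z j) \<longlongrightarrow> y j) F)"
proof
  assume L: "filterlim g (coord_nhds m y) F"
  show "\<forall>j<m. ((\<lambda>z. g z j) \<longlongrightarrow> y j) F"
    unfolding tendsto_iff dist_real_def
  proof (intro allI impI)
    fix j and e :: real assume "j < m" "e > 0"
    then have "eventually (\<lambda>z. \<bar>z j - y j\<bar> < e) (coord_nhds m y)"
      unfolding eventually_coord_nhds by blast
    then show "eventually (\<lambda>z. \<bar>g z j - y j\<bar> < e) F"
      using L unfolding filterlim_iff by blast
  qed
next
  assume R: "\<forall>j<m. ((\<lambda>z. g z j) \<longlongrightarrow> y j) F"
  show "filterlim g (coord_nhds m y) F"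
    unfolding filterlim_iff eventually_coord_nhds
  proof (intro allI impI, elim exE conjE)
    fix P d assume d: "d > 0" "\<forall>z. (\<forall>i<m. \<bar>z i - y i\<bar> < d) \<longrightarrow> P z"
    have "eventually (\<lambda>z. \<forall>j\<in>{..<m}. \<bar>g z j - y j\<bar> < d) F"
      using R d(1) by (intro eventually_ball_finite) (auto simp: tendsto_iff dist_real_def)
    then show "eventually (\<lambda>z. P (g z)) F"
      by eventually_elim (use d in auto)
  qed
qed

lemma tendsto_coord: "i < n \<Longrightarrow> ((\<lambda>y. y i) \<longlongrightarrow> x i) (coord_nhds n x)"
  using filterlim_ident[of "coord_nhds n x"] unfolding tendsto_coord_nhds_iff by blast

section \<open>The coinductive class of smooth functions and its ring structure\<close>

lemma smooth_fun_depends_on: "f \<in> smooth_fun n \<Longrightarrow> depends_on n f"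
  by (auto elim: smooth_fun.cases)

lemma smooth_fun_cong:
  assumes "f \<in> smooth_fun n" "\<And>i. i < n \<Longrightarrow> x i = y i" shows "f x = f y"
  using smooth_fun_depends_on[OF assms(1)] assms(2) unfolding depends_on_def by simp

lemma smooth_fun_cont_n: "f \<in> smooth_fun n \<Longrightarrow> cont_n n f"
  by (auto elim: smooth_fun.cases)

lemma smooth_fun_partial_deriv:
  "f \<in> smooth_fun n \<Longrightarrow> i < n \<Longrightarrow> \<exists>g\<in>smooth_fun n. partial_deriv i f g"
  unfolding partial_deriv_def by (erule smooth_fun.cases) blast

text \<open>Polynomials with real coefficients in the members of \<open>B\<close>. Product and chain
  rules leave a generating family but stay inside such polynomials.\<close>

inductive_set alg :: "((nat \<Rightarrow> real) \<Rightarrow> real) set \<Rightarrow> ((nat \<Rightarrow> real) \<Rightarrow> real) set" for B where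
  alg_base: "f \<in> B \<Longrightarrow> f \<in> alg B"
| alg_const: "(\<lambda>_. c) \<in> alg B"
| alg_add: "f \<in> alg B \<Longrightarrow> g \<in> alg B \<Longrightarrow> (\<lambda>x. f x + g x) \<in> alg B"
| alg_mult: "f \<in> alg B \<Longrightarrow> g \<in> alg B \<Longrightarrow> (\<lambda>x. f x * g x) \<in> alg B"

lemma alg_sum:
  "(\<And>i. i \<in> I \<Longrightarrow> f i \<in> alg B) \<Longrightarrow> (\<lambda>x. \<Sum>i\<in>I. f i x) \<in> alg B"
  by (induction I rule: infinite_finite_induct) (auto intro: alg.intros)

text \<open>Coinduction up to sums and products: partial derivatives only need to be polynomials in \<open>B\<close>.\<close>

lemma alg_subset_smooth_fun:
  assumes dep: "\<And>f. f \<in> B \<Longrightarrow> depends_on n f"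
    and cont: "\<And>f. f \<in> B \<Longrightarrow> cont_n n f"
    and pd: "\<And>f i. f \<in> B \<Longrightarrow> i < n \<Longrightarrow> \<exists>g\<in>alg B. partial_deriv i f g"
  shows "alg B \<subseteq> smooth_fun n"
proof
  fix f assume "f \<in> alg B"
  then show "f \<in> smooth_fun n"
  \<comment> \<open>The invariant is membership in \<open>alg B\<close>; an inner induction over the
    polynomial carries dependence, continuity and derivatives through sums and products.\<close>
  proof (coinduction arbitrary: f)
    case smooth_fun
    then have "depends_on n f \<and> cont_n n f \<and> (\<forall>i<n. \<exists>g\<in>alg B. partial_deriv i f g)"
    proof induction
      case (alg_base f)
      then show ?case using assms by blast
    next
      case (alg_const c)
      show ?case
        by (auto simp: depends_on_def cont_n_iff partial_deriv_def intro!: bexI[of _ "\<lambda>_. 0"] alg.intros)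
    next
      case (alg_add f g)
      have "\<exists>k\<in>alg B. partial_deriv i (\<lambda>x. f x + g x) k" if i: "i < n" for i
      proof -
        obtain f' g' where "f' \<in> alg B" "g' \<in> alg B" "partial_deriv i f f'" "partial_deriv i g g'"
          using alg_add.IH i by blast
        then show ?thesis
          by (intro bexI[of _ "\<lambda>x. f' x + g' x"] alg.alg_add)
            (auto simp: partial_deriv_def intro: DERIV_add)
      qed
      moreover have "depends_on n (\<lambda>x. f x + g x)"
        using alg_add.IH unfolding depends_on_def by metis
      ultimately show ?case
        using alg_add.IH by (auto simp: cont_n_iff intro: tendsto_add)
    next
      case (alg_mult f g)
      have "\<exists>k\<in>alg B. partial_deriv i (\<lambda>x. f x * g x) k" if i: "i < n" for i
      proof -
        obtain f' g' where "f' \<in> alg B" "g' \<in> alg B" "partial_deriv i f f'" "partial_deriv i g g'"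
          using alg_mult.IH i by blast
        then show ?thesis using alg_mult.hyps
          by (intro bexI[of _ "\<lambda>x. f' x * g x + g' x * f x"] alg.alg_add alg.alg_mult)
            (auto simp: partial_deriv_def intro: DERIV_mult[THEN DERIV_cong])
      qed
      moreover have "depends_on n (\<lambda>x. f x * g x)"
        using alg_mult.IH unfolding depends_on_def by metis
      ultimately show ?case
        using alg_mult.IH by (auto simp: cont_n_iff intro: tendsto_mult)
    qed
    then show ?case by (auto simp: partial_deriv_def)
  qed
qed

text \<open>Smooth functions satisfy the hypotheses of the up-to principle themselves, which yields
  closure under constants, sums and products at once.\<close>

lemma alg_smooth_fun: "alg (smooth_fun n) = smooth_fun n"
proof
  show "alg (smooth_fun n) \<subseteq> smooth_fun n"
    by (rule alg_subset_smooth_fun)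
      (use smooth_fun_depends_on smooth_fun_cont_n smooth_fun_partial_deriv alg_base in blast)+
qed (auto intro: alg_base)

lemma smooth_const [intro, simp]: "(\<lambda>_. c) \<in> smooth_fun n"
  using alg_const[of c "smooth_fun n"] by (simp add: alg_smooth_fun)

lemma smooth_add [intro, simp]:
  "f \<in> smooth_fun n \<Longrightarrow> g \<in> smooth_fun n \<Longrightarrow> (\<lambda>x. f x + g x) \<in> smooth_fun n"
  using alg_add[of f "smooth_fun n" g] by (simp add: alg_smooth_fun)

lemma smooth_mult [intro, simp]:
  "f \<in> smooth_fun n \<Longrightarrow> g \<in> smooth_fun n \<Longrightarrow> (\<lambda>x. f x * g x) \<in> smooth_fun n"
  using alg_mult[of f "smooth_fun n" g] by (simp add: alg_smooth_fun)

lemma smooth_uminus [intro, simp]: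
  "f \<in> smooth_fun n \<Longrightarrow> (\<lambda>x. - f x) \<in> smooth_fun n"
  using smooth_mult[OF smooth_const[of "-1"]] by simp

lemma smooth_diff [intro, simp]:
  "f \<in> smooth_fun n \<Longrightarrow> g \<in> smooth_fun n \<Longrightarrow> (\<lambda>x. f x - g x) \<in> smooth_fun n"
  using smooth_add[OF _ smooth_uminus, of f n g] by simp

lemma smooth_power [intro, simp]:
  "f \<in> smooth_fun n \<Longrightarrow> (\<lambda>x. f x ^ k) \<in> smooth_fun n"
  by (induction k) auto

lemma smooth_prod:
  "(\<And>i. i \<in> I \<Longrightarrow> f i \<in> smooth_fun n) \<Longrightarrow> (\<lambda>x. \<Prod>i\<in>I. f i x) \<in> smooth_fun n"
  by (induction I rule: infinite_finite_induct) auto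

lemma smooth_coord [intro, simp]:
  assumes "i < n" shows "(\<lambda>x. x i) \<in> smooth_fun n"
proof -
  have "alg {\<lambda>x. x i} \<subseteq> smooth_fun n"
  proof (rule alg_subset_smooth_fun)
    fix f :: "(nat \<Rightarrow> real) \<Rightarrow> real" and j assume "f \<in> {\<lambda>x. x i}" "j < n"
    then show "\<exists>g\<in>alg {\<lambda>x. x i}. partial_deriv j f g"
      by (intro bexI[of _ "\<lambda>_. if j = i then 1 else 0"])
        (auto simp: partial_deriv_def intro: alg.intros)
  qed (use assms in \<open>auto simp: depends_on_def cont_n_iff tendsto_coord\<close>)
  then show ?thesis by (auto intro: alg_base)
qed

section \<open>The chain rule and closure under composition\<close>

lemma mvt_symmetric:
  fixes F F' :: "real \<Rightarrow> real"
  assumes "\<And>t. (F has_real_derivative F' t) (at t)"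
  shows "\<exists>z. \<bar>z - a\<bar> \<le> \<bar>b - a\<bar> \<and> F b - F a = F' z * (b - a)"
proof (cases a b rule: linorder_cases)
  case less
  obtain z where "a < z" "z < b" "F b - F a = (b - a) * F' z"
    using MVT2[OF less] assms by blast
  then show ?thesis by (intro exI[of _ z]) auto
next
  case greater
  obtain z where "b < z" "z < a" "F a - F b = (a - b) * F' z"
    using MVT2[OF greater] assms by blast
  then show ?thesis by (intro exI[of _ z]) (auto simp: algebra_simps)
qed auto

lemma partial_deriv_line:
  assumes "partial_deriv i f g"
  shows "((\<lambda>t. f (x(i := t))) has_real_derivative g (x(i := s))) (at s)"
  using assms[unfolded partial_deriv_def, rule_format, of "x(i := s)"] by simp

text \<open>The coordinates are moved one at a time: moving coordinate \<open>k\<close> changes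
  \<open>f\<close> by a mean value of \<open>df k\<close> times the increment of
  \<open>\<gamma> k\<close>, and continuity of \<open>df k\<close> identifies the limit.\<close>

lemma chain_rule_partial_derivs:
  fixes \<gamma> :: "nat \<Rightarrow> real \<Rightarrow> real"
  assumes f: "depends_on m f" 
    and pd: "\<And>j. j < m \<Longrightarrow> partial_deriv j f (df j)" 
    and cont: "\<And>j. j < m \<Longrightarrow> cont_n m (df j)"
    and \<gamma>: "\<And>j. j < m \<Longrightarrow> (\<gamma> j has_real_derivative \<gamma>' j) (at s)"
  shows "((\<lambda>t. f (\<lambda>j. \<gamma> j t)) has_real_derivative (\<Sum>j<m. df j (\<lambda>j. \<gamma> j s) * \<gamma>' j)) (at s)"
proof -
  \<comment> \<open>The hybrid point: the first \<open>k\<close> coordinates have moved to time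
    \<open>t\<close>, the others still sit at time \<open>s\<close>.\<close>
  define y where "y k t = (\<lambda>j. if j < k then \<gamma> j t else \<gamma> j s)" for k t
  have "((\<lambda>t. f (y k t)) has_real_derivative (\<Sum>j<k. df j (\<lambda>j. \<gamma> j s) * \<gamma>' j)) (at s)" if "k \<le> m" for k
    using that
  proof (induction k)
    case 0
    then show ?case by (simp add: y_def)
  next
    case (Suc k)
    then have k: "k < m" by simp
    \<comment> \<open>Caratheodory's form of the derivative avoids dividing by \<open>t - s\<close>;
      slopes are functions continuous at \<open>s\<close> and can be multiplied.\<close>
    obtain c where c: "\<And>t. \<gamma> k t - \<gamma> k s = c t * (t - s)" "isCont c s" "c s = \<gamma>' k"
      using \<gamma>[OF k] unfolding CARAT_DERIV by blast
    have "\<forall>t. \<exists>z. \<bar>z - \<gamma> k s\<bar> \<le> \<bar>\<gamma> k t - \<gamma> k s\<bar> \<and>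
        f ((y k t)(k := \<gamma> k t)) - f ((y k t)(k := \<gamma> k s)) = df k ((y k t)(k := z)) * (\<gamma> k t - \<gamma> k s)"
      using mvt_symmetric[OF partial_deriv_line[OF pd[OF k]]] by blast
    then obtain z where z: "\<And>t. \<bar>z t - \<gamma> k s\<bar> \<le> \<bar>\<gamma> k t - \<gamma> k s\<bar>"
        "\<And>t. f ((y k t)(k := \<gamma> k t)) - f ((y k t)(k := \<gamma> k s)) = df k ((y k t)(k := z t)) * (\<gamma> k t - \<gamma> k s)"
      by metis
    have tends: "(\<gamma> j \<longlongrightarrow> \<gamma> j s) (at s)" if "j < m" for j
      using DERIV_isCont[OF \<gamma>[OF that]] by (simp add: isCont_def)
    have "((\<lambda>t. \<bar>z t - \<gamma> k s\<bar>) \<longlongrightarrow> 0) (at s)"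
    proof (rule tendsto_sandwich[of "\<lambda>_. 0" _ _ "\<lambda>t. \<bar>\<gamma> k t - \<gamma> k s\<bar>"])
      show "((\<lambda>t. \<bar>\<gamma> k t - \<gamma> k s\<bar>) \<longlongrightarrow> 0) (at s)"
        using tends[OF k] by (simp add: LIM_zero tendsto_rabs_zero)
    qed (auto simp: z)
    then have zt: "(z \<longlongrightarrow> \<gamma> k s) (at s)"
      by (simp add: tendsto_rabs_zero_iff LIM_zero_iff)
    have "filterlim (\<lambda>t. (y k t)(k := z t)) (coord_nhds m (\<lambda>j. \<gamma> j s)) (at s)"
      unfolding tendsto_coord_nhds_iff
    proof (intro allI impI)
      fix j assume "j < m"
      then show "((\<lambda>t. ((y k t)(k := z t)) j) \<longlongrightarrow> \<gamma> j s) (at s)"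
        using zt tends[of j] by (cases j k rule: linorder_cases) (auto simp: y_def)
    qed
    moreover have "(df k \<longlongrightarrow> df k (\<lambda>j. \<gamma> j s)) (coord_nhds m (\<lambda>j. \<gamma> j s))"
      using cont[OF k] by (simp add: cont_n_iff)
    ultimately have D: "((\<lambda>t. df k ((y k t)(k := z t))) \<longlongrightarrow> df k (\<lambda>j. \<gamma> j s)) (at s)"
      by (rule filterlim_compose[rotated])
    have zs: "(y k s)(k := z s) = (\<lambda>j. \<gamma> j s)"
      using z(1)[of s] by (auto simp: y_def)
    have "((\<lambda>t. f (y (Suc k) t) - f (y k t)) has_real_derivative df k (\<lambda>j. \<gamma> j s) * \<gamma>' k) (at s)"
      unfolding CARAT_DERIV
    proof (intro exI[of _ "\<lambda>t. df k ((y k t)(k := z t)) * c t"] conjI allI)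
      fix t
      have "y (Suc k) t = (y k t)(k := \<gamma> k t)" "y k t = (y k t)(k := \<gamma> k s)" "y (Suc k) s = y k s"
        by (auto simp: y_def less_Suc_eq fun_eq_iff)
      then show "f (y (Suc k) t) - f (y k t) - (f (y (Suc k) s) - f (y k s)) =
          df k ((y k t)(k := z t)) * c t * (t - s)"
        using z(2)[of t] c(1)[of t] by (metis diff_self diff_zero mult.assoc)
    next
      show "isCont (\<lambda>t. df k ((y k t)(k := z t)) * c t) s"
        unfolding isCont_def zs using D c(2) by (intro tendsto_mult) (auto simp: isCont_def)
    next
      show "df k ((y k s)(k := z s)) * c s = df k (\<lambda>j. \<gamma> j s) * \<gamma>' k"
        using zs c(3) by simp
    qed
    from DERIV_add[OF Suc.IH this] k show ?case by simp
  qed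
  from this[OF order_refl] have "((\<lambda>t. f (y m t)) has_real_derivative (\<Sum>j<m. df j (\<lambda>j. \<gamma> j s) * \<gamma>' j)) (at s)" .
  moreover have "f (y m t) = f (\<lambda>j. \<gamma> j t)" for t
    using f by (auto simp: depends_on_def y_def)
  ultimately show ?thesis by simp
qed

lemma smooth_compose:
  assumes f: "f \<in> smooth_fun m" and g: "\<And>j. j < m \<Longrightarrow> g j \<in> smooth_fun n"
  shows "(\<lambda>x. f (\<lambda>j. g j x)) \<in> smooth_fun n"
proof -
  \<comment> \<open>The chain rule multiplies composites by derivatives of the \<open>g j\<close>.
    Including all smooth functions of \<open>n\<close> variables makes every such derivative a
    polynomial in \<open>B\<close>.\<close>
  define B where "B = {\<lambda>x. f (\<lambda>j. g j x) | f. f \<in> smooth_fun m} \<union> smooth_fun n"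
  have "alg B \<subseteq> smooth_fun n"
  proof (rule alg_subset_smooth_fun)
    fix h assume "h \<in> B"
    then show "depends_on n h"
      unfolding B_def
    proof safe
      fix f assume f: "f \<in> smooth_fun m"
      show "depends_on n (\<lambda>x. f (\<lambda>j. g j x))"
        unfolding depends_on_def
      proof safe
        fix x y :: "nat \<Rightarrow> real" assume "\<forall>i<n. x i = y i"
        then show "f (\<lambda>j. g j x) = f (\<lambda>j. g j y)"
          by (intro smooth_fun_cong[OF f] smooth_fun_cong[OF g]) auto
      qed
    qed (rule smooth_fun_depends_on)
  next
    fix h assume "h \<in> B"
    then show "cont_n n h"
      unfolding B_def
    proof safe
      fix f assume f: "f \<in> smooth_fun m"
      show "cont_n n (\<lambda>x. f (\<lambda>j. g j x))"
        unfolding cont_n_iff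
      proof
        fix x
        have "filterlim (\<lambda>x j. g j x) (coord_nhds m (\<lambda>j. g j x)) (coord_nhds n x)"
          using smooth_fun_cont_n[OF g] by (simp add: tendsto_coord_nhds_iff cont_n_iff)
        moreover have "(f \<longlongrightarrow> f (\<lambda>j. g j x)) (coord_nhds m (\<lambda>j. g j x))"
          using smooth_fun_cont_n[OF f] by (simp add: cont_n_iff)
        ultimately show "((\<lambda>x. f (\<lambda>j. g j x)) \<longlongrightarrow> f (\<lambda>j. g j x)) (coord_nhds n x)"
          by (rule filterlim_compose[rotated])
      qed
    qed (rule smooth_fun_cont_n)
  next
    fix h i assume "h \<in> B" and i: "i < n"
    then show "\<exists>k\<in>alg B. partial_deriv i h k"
      unfolding B_def
    proof (elim UnE CollectE exE conjE)
      fix f assume f: "f \<in> smooth_fun m" and h: "h = (\<lambda>x. f (\<lambda>j. g j x))"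
      obtain df where df: "\<And>j. j < m \<Longrightarrow> df j \<in> smooth_fun m" "\<And>j. j < m \<Longrightarrow> partial_deriv j f (df j)"
        using smooth_fun_partial_deriv[OF f] by metis
      obtain dg where dg: "\<And>j. j < m \<Longrightarrow> dg j \<in> smooth_fun n" "\<And>j. j < m \<Longrightarrow> partial_deriv i (g j) (dg j)"
        using smooth_fun_partial_deriv[OF g i] by metis
      have "partial_deriv i h (\<lambda>x. \<Sum>j<m. df j (\<lambda>j. g j x) * dg j x)"
        unfolding partial_deriv_def h
      proof
        fix x
        show "((\<lambda>t. f (\<lambda>j. g j (x(i := t)))) has_real_derivative
            (\<Sum>j<m. df j (\<lambda>j. g j x) * dg j x)) (at (x i))"
          using chain_rule_partial_derivs[OF smooth_fun_depends_on[OF f] df(2) smooth_fun_cont_n[OF df(1)],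
              where \<gamma> = "\<lambda>j t. g j (x(i := t))" and s = "x i" and \<gamma>' = "\<lambda>j. dg j x"]
            dg(2) by (simp add: partial_deriv_def)
      qed
      moreover have "(\<lambda>x. \<Sum>j<m. df j (\<lambda>j. g j x) * dg j x) \<in> alg B"
        using df(1) dg(1) by (intro alg_sum alg_mult alg_base) (auto simp: B_def)
      ultimately show "\<exists>k\<in>alg ({\<lambda>x. f (\<lambda>j. g j x) |f. f \<in> smooth_fun m} \<union> smooth_fun n). partial_deriv i h k"
        unfolding B_def by blast
    next
      assume "h \<in> smooth_fun n"
      with smooth_fun_partial_deriv[OF this i]
      show "\<exists>k\<in>alg ({\<lambda>x. f (\<lambda>j. g j x) |f. f \<in> smooth_fun m} \<union> smooth_fun n). partial_deriv i h k"
        by (auto intro: alg_base)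
    qed
  qed
  then show ?thesis using f by (auto simp: B_def intro: alg_base)
qed

section \<open>Exponential, logarithm and flat functions\<close>

text \<open>The up-to principle for one variable. Whole families are allowed because differentiating
  a quotient by a power of \<open>t\<close> raises the power.\<close>

lemma smooth_univariate_family:
  fixes B :: "(real \<Rightarrow> real) set"
  assumes deriv: "\<And>\<phi>. \<phi> \<in> B \<Longrightarrow> \<exists>\<psi>. (\<lambda>x. \<psi> (x 0)) \<in> alg ((\<lambda>\<phi> x. \<phi> (x 0)) ` B) \<and>
      (\<forall>t. (\<phi> has_real_derivative \<psi> t) (at t))"
    and "\<phi> \<in> B"
  shows "(\<lambda>x. \<phi> (x 0)) \<in> smooth_fun 1"
proof -
  let ?B = "(\<lambda>\<phi> x. \<phi> (x 0)) ` B :: ((nat \<Rightarrow> real) \<Rightarrow> real) set"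
  have "alg ?B \<subseteq> smooth_fun 1"
  proof (rule alg_subset_smooth_fun)
    fix f :: "(nat \<Rightarrow> real) \<Rightarrow> real" assume "f \<in> ?B"
    then obtain \<phi> where f: "f = (\<lambda>x. \<phi> (x 0))" and "\<phi> \<in> B" by (rule imageE)
    from deriv[OF \<open>\<phi> \<in> B\<close>] obtain \<psi>
      where \<psi>: "(\<lambda>x. \<psi> (x 0)) \<in> alg ?B" "\<And>t. (\<phi> has_real_derivative \<psi> t) (at t)"
      by (elim exE conjE) simp
    show "depends_on 1 f"
      by (simp add: f depends_on_def)
    have "isCont \<phi> t" for t
      using \<psi>(2) by (rule DERIV_isCont)
    then show "cont_n 1 f"
      unfolding f cont_n_iff by (intro allI isCont_tendsto_compose[of _ \<phi>] tendsto_coord) auto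
    show "\<exists>g\<in>alg ?B. partial_deriv i f g" if "i < 1" for i
      using that \<psi> by (intro bexI[of _ "\<lambda>x. \<psi> (x 0)"]) (auto simp: f partial_deriv_def)
  qed
  moreover have "(\<lambda>x. \<phi> (x 0)) \<in> alg ?B"
    using \<open>\<phi> \<in> B\<close> by (intro alg_base imageI)
  ultimately show ?thesis by (rule subsetD)
qed

lemma smooth_univariate_compose:
  assumes "(\<lambda>x. \<phi> (x 0)) \<in> smooth_fun 1" "G \<in> smooth_fun n"
  shows "(\<lambda>x. \<phi> (G x)) \<in> smooth_fun n"
  using smooth_compose[OF assms(1), of "\<lambda>_. G"] assms(2) by simp

lemma smooth_exp [intro, simp]:
  assumes "G \<in> smooth_fun n" shows "(\<lambda>x. exp (G x)) \<in> smooth_fun n"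
proof -
  have "(\<lambda>x. exp (x 0)) \<in> smooth_fun 1"
  proof (rule smooth_univariate_family[of "{exp}"])
    fix \<phi> :: "real \<Rightarrow> real" assume "\<phi> \<in> {exp}"
    then show "\<exists>\<psi>. (\<lambda>x. \<psi> (x 0)) \<in> alg ((\<lambda>\<phi> x. \<phi> (x 0)) ` {exp}) \<and>
        (\<forall>t. (\<phi> has_real_derivative \<psi> t) (at t))"
      by (intro exI[of _ exp]) (simp add: alg_base DERIV_exp)
  qed simp
  then show ?thesis using assms by (rule smooth_univariate_compose)
qed

lemma partial_deriv_univariate_compose:
  assumes "partial_deriv i G G'" "\<And>x. (\<phi> has_real_derivative \<psi> x) (at (G x))"
  shows "partial_deriv i (\<lambda>x. \<phi> (G x)) (\<lambda>x. \<psi> x * G' x)"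
  unfolding partial_deriv_def
proof
  fix x
  show "((\<lambda>t. \<phi> (G (x(i := t)))) has_real_derivative \<psi> x * G' x) (at (x i))"
    by (rule DERIV_chain2[where f = \<phi> and g = "\<lambda>t. G (x(i := t))"])
      (use assms in \<open>auto simp: partial_deriv_def\<close>)
qed

text \<open>Both functions are handled at once: the derivative of the logarithm involves the
  reciprocal, and that of the reciprocal involves its square.\<close>

lemma smooth_ln_inverse:
  assumes G: "G \<in> smooth_fun n" and pos: "\<And>x. G x > 0"
  shows "(\<lambda>x. ln (G x)) \<in> smooth_fun n" and "(\<lambda>x. inverse (G x)) \<in> smooth_fun n"
proof -
  define B where "B = {\<lambda>x. ln (G x), \<lambda>x. inverse (G x)} \<union> smooth_fun n"
  have nz: "G x \<noteq> 0" for x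
    using pos[of x] by simp
  have "alg B \<subseteq> smooth_fun n"
  proof (rule alg_subset_smooth_fun)
    fix f assume "f \<in> B"
    then consider "f = (\<lambda>x. ln (G x))" | "f = (\<lambda>x. inverse (G x))" | "f \<in> smooth_fun n"
      unfolding B_def by blast
    then have "depends_on n f \<and> cont_n n f"
    proof cases
      case 1
      have "depends_on n f"
        unfolding depends_on_def 1 using smooth_fun_cong[OF G] by metis
      then show ?thesis
        using smooth_fun_cont_n[OF G] nz unfolding 1 cont_n_iff by (auto intro: tendsto_ln)
    next
      case 2
      have "depends_on n f"
        unfolding depends_on_def 2 using smooth_fun_cong[OF G] by metis
      then show ?thesis
        using smooth_fun_cont_n[OF G] nz unfolding 2 cont_n_iff by (auto intro: tendsto_inverse)
    next
      case 3
      then show ?thesis by (simp add: smooth_fun_depends_on smooth_fun_cont_n)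
    qed
    then show "depends_on n f" "cont_n n f" by auto
  next
    fix f i assume f: "f \<in> B" and i: "i < n"
    obtain G' where G': "G' \<in> smooth_fun n" "partial_deriv i G G'"
      using smooth_fun_partial_deriv[OF G i] by blast
    have inB: "(\<lambda>x. inverse (G x)) \<in> alg B" "\<And>h. h \<in> smooth_fun n \<Longrightarrow> h \<in> alg B"
      by (auto simp: B_def intro: alg_base)
    consider "f = (\<lambda>x. ln (G x))" | "f = (\<lambda>x. inverse (G x))" | "f \<in> smooth_fun n"
      using f unfolding B_def by blast
    then show "\<exists>g\<in>alg B. partial_deriv i f g"
    proof cases
      case 1
      have "partial_deriv i f (\<lambda>x. inverse (G x) * G' x)"
        unfolding 1 by (rule partial_deriv_univariate_compose[OF G'(2)]) (rule DERIV_ln[OF pos])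
      then show ?thesis
        using inB G' by (intro bexI[of _ "\<lambda>x. inverse (G x) * G' x"] alg_mult) auto
    next
      case 2
      have "partial_deriv i f (\<lambda>x. - (inverse (G x) ^ Suc (Suc 0)) * G' x)"
        unfolding 2 by (rule partial_deriv_univariate_compose[OF G'(2)]) (rule DERIV_inverse[OF nz])
      then have "partial_deriv i f (\<lambda>x. (- G' x) * (inverse (G x) * inverse (G x)))"
        by (simp add: mult.commute)
      then show ?thesis
        using inB smooth_uminus[OF G'(1)]
        by (intro bexI[of _ "\<lambda>x. (- G' x) * (inverse (G x) * inverse (G x))"] alg_mult) auto
    next
      case 3
      then show ?thesis
        using smooth_fun_partial_deriv[OF 3 i] inB(2) by blast
    qed
  qed
  then show "(\<lambda>x. ln (G x)) \<in> smooth_fun n" "(\<lambda>x. inverse (G x)) \<in> smooth_fun n"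
    unfolding B_def by (auto intro: alg_base)
qed

lemma smooth_divide:
  assumes "F \<in> smooth_fun n" "G \<in> smooth_fun n" "\<And>x. G x > 0"
  shows "(\<lambda>x. F x / G x) \<in> smooth_fun n"
  using smooth_mult[OF assms(1) smooth_ln_inverse(2)[OF assms(2,3)]] by (simp add: divide_inverse)

lemma smooth_sqrt:
  assumes G: "G \<in> smooth_fun n" and pos: "\<And>x. G x > 0"
  shows "(\<lambda>x. sqrt (G x)) \<in> smooth_fun n"
proof -
  have "sqrt (G x) = exp (ln (G x) * (1 / 2))" for x
    using pos[of x] by (simp add: powr_half_sqrt[symmetric] powr_def)
  then show ?thesis
    using smooth_exp[OF smooth_mult[OF smooth_ln_inverse(1)[OF G pos] smooth_const[of "1/2"]]] by simp
qed

section \<open>Flat functions on the half-line\<close>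

text \<open>Away from \<open>0\<close> the glued function agrees locally with \<open>f\<close> or
  with \<open>0\<close>; at \<open>0\<close> its left difference quotient is \<open>f t / t\<close>,
  its value there being \<open>0\<close>.\<close>

lemma DERIV_zero_extension:
  fixes f :: "real \<Rightarrow> real"
  assumes neg: "t < 0 \<Longrightarrow> (f has_real_derivative D) (at t)"
    and zero: "t = 0 \<Longrightarrow> ((\<lambda>t. f t / t) \<longlongrightarrow> 0) (at_left 0)"
    and D: "t \<ge> 0 \<Longrightarrow> D = 0"
  shows "((\<lambda>t. if t < 0 then f t else 0) has_real_derivative D) (at t)"
proof (cases t "0::real" rule: linorder_cases)
  case less
  have "eventually (\<lambda>s. s \<in> {..<0}) (nhds t)"
    using less by (intro eventually_nhds_in_open) auto
  then have "eventually (\<lambda>s. (if s < 0 then f s else 0) = f s) (nhds t)"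
    by eventually_elim auto
  then show ?thesis
    using neg[OF less] less by (subst DERIV_cong_ev[OF refl _ refl]) auto
next
  case equal
  have "((\<lambda>t. (if t < 0 then f t else 0) / t) \<longlongrightarrow> 0) (at_left 0)"
    using zero[OF equal]
    by (rule Lim_transform_eventually) (auto simp: eventually_at_filter)
  moreover have "((\<lambda>t. (if t < 0 then f t else 0) / t) \<longlongrightarrow> 0) (at_right (0::real))"
    by (rule Lim_transform_eventually[OF tendsto_const]) (auto simp: eventually_at_filter)
  ultimately show ?thesis
    using D equal by (simp add: has_field_derivative_iff filterlim_at_split)
next
  case greater
  have "eventually (\<lambda>s. s \<in> {0<..}) (nhds t)"
    using greater by (intro eventually_nhds_in_open) auto
  then have "eventually (\<lambda>s. (if s < 0 then f s else 0) = 0) (nhds t)"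
    by eventually_elim auto
  then show ?thesis
    using D greater by (subst DERIV_cong_ev[OF refl _ refl]) auto
qed

text \<open>The classical flat function, reflected so that it vanishes on the half-line and hence at
  every element of \<open>Hset\<close>.\<close>

definition exp_flat :: "real \<Rightarrow> real" where
  "exp_flat t = (if t < 0 then exp (1 / t) else 0)"

text \<open>The substitution \<open>x = - 1 / t\<close> gives, up to the sign
  \<open>(-1) ^ k\<close>, the decay of \<open>x ^ k / exp x\<close> at infinity.\<close>

lemma exp_div_power_tendsto_0:
  "((\<lambda>t::real. exp (1 / t) / t ^ k) \<longlongrightarrow> 0) (at_left 0)"
proof -
  have "((\<lambda>x::real. (-1) ^ k * (x ^ k / exp x)) \<longlongrightarrow> (-1) ^ k * 0) at_top"
    by (intro tendsto_intros tendsto_power_div_exp_0)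
  moreover have "filterlim (\<lambda>t::real. - inverse t) at_top (at_left 0)"
    by (simp add: filterlim_inverse_at_bot_neg flip: filterlim_uminus_at_bot)
  ultimately have "((\<lambda>t::real. (-1) ^ k * ((- inverse t) ^ k / exp (- inverse t))) \<longlongrightarrow> (-1) ^ k * 0) (at_left 0)"
    by (rule filterlim_compose)
  moreover have "(-1) ^ k * ((- inverse t) ^ k / exp (- inverse t)) = exp (1 / t) / t ^ k" for t :: real
    by (simp add: exp_minus power_minus[of "inverse t"] divide_inverse power_inverse
        flip: mult.assoc power_mult_distrib)
  ultimately show ?thesis by simp
qed

lemma smooth_exp_flat: "(\<lambda>x. exp_flat (x 0)) \<in> smooth_fun 1"
proof -
  \<comment> \<open>All powers of \<open>1 / t\<close> are needed as factors: the derivative of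
    \<open>e k\<close> is \<open>- k * e (k + 1) - e (k + 2)\<close>.\<close>
  define e where "e k t = (if t < 0 then exp (1 / t) / t ^ k else 0)" for k and t :: real
  let ?B = "(\<lambda>\<phi> x. \<phi> (x 0)) ` range e :: ((nat \<Rightarrow> real) \<Rightarrow> real) set"
  have "(\<lambda>x. e 0 (x 0)) \<in> smooth_fun 1"
  proof (rule smooth_univariate_family[of "range e"])
    fix \<phi> assume "\<phi> \<in> range e"
    then obtain k where \<phi>: "\<phi> = e k" by blast
    define \<psi> where "\<psi> t = (- real k) * e (k + 1) t + (-1) * e (k + 2) t" for t
    have "(\<phi> has_real_derivative \<psi> t) (at t)" for t
      unfolding \<phi> e_def [abs_def]
    proof (rule DERIV_zero_extension)
      assume t: "t < 0"
      have "((\<lambda>t. exp (1 / t) * inverse t ^ k) has_real_derivative \<psi> t) (at t)"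
        using t
        apply (auto intro!: derivative_eq_intros simp: \<psi>_def e_def)
        \<comment> \<open>The power rule leaves the exponent \<open>k - 1\<close>, so
          \<open>k = 0\<close> is treated separately.\<close>
        apply (cases k)
        apply (auto simp: field_simps power2_eq_square)
        done
      then show "((\<lambda>t. exp (1 / t) / t ^ k) has_real_derivative \<psi> t) (at t)"
        by (simp add: divide_inverse power_inverse)
    next
      show "((\<lambda>t::real. exp (1 / t) / t ^ k / t) \<longlongrightarrow> 0) (at_left 0)"
        using exp_div_power_tendsto_0[of "Suc k"] by (simp add: mult.commute)
    qed (auto simp: \<psi>_def e_def)
    moreover have "(\<lambda>x. \<psi> (x 0)) \<in> alg ?B"
      unfolding \<psi>_def by (intro alg_add alg_mult alg_const; rule alg_base) auto
    ultimately show "\<exists>\<psi>. (\<lambda>x. \<psi> (x 0)) \<in> alg ?B \<and> (\<forall>t. (\<phi> has_real_derivative \<psi> t) (at t))"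
      by blast
  qed auto
  moreover have "e 0 = exp_flat"
    by (auto simp: e_def exp_flat_def)
  ultimately show ?thesis by simp
qed

lemma smooth_fun_1_eq: "f \<in> smooth_fun 1 \<Longrightarrow> f x = f (\<lambda>_. x 0)"
  by (rule smooth_fun_cong) auto

lemma smooth_univariate_deriv:
  assumes "(\<lambda>x. \<phi> (x 0)) \<in> smooth_fun 1"
  obtains \<psi> where "(\<lambda>x. \<psi> (x 0)) \<in> smooth_fun 1" "\<And>t. (\<phi> has_real_derivative \<psi> t) (at t)"
proof -
  obtain g where g: "g \<in> smooth_fun 1" "partial_deriv 0 (\<lambda>x. \<phi> (x 0)) g"
    using smooth_fun_partial_deriv[OF assms] by auto
  have "(\<lambda>x. g (\<lambda>_. x 0)) \<in> smooth_fun 1"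
    using g(1) smooth_fun_1_eq[OF g(1), symmetric] by simp
  moreover have "(\<phi> has_real_derivative g (\<lambda>_. t)) (at t)" for t
    using g(2)[unfolded partial_deriv_def, rule_format, of "\<lambda>_. t"] by simp
  ultimately show ?thesis by (rule that)
qed

text \<open>The ideal whose quotient is \<open>C\<^sup>\<infinity>[0,\<infinity>)\<close>, written
  with functions of a real number.\<close>

definition flat :: "(real \<Rightarrow> real) set" where
  "flat = {\<phi>. (\<lambda>x. \<phi> (x 0)) \<in> smooth_fun 1 \<and> (\<forall>t\<ge>0. \<phi> t = 0)}"

text \<open>On the half-line the derivative can be computed from the right, where all difference
  quotients are zero.\<close>

lemma flat_deriv:
  assumes "\<phi> \<in> flat"
  obtains \<psi> where "\<psi> \<in> flat" "\<And>t. (\<phi> has_real_derivative \<psi> t) (at t)"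
proof -
  have \<phi>: "(\<lambda>x. \<phi> (x 0)) \<in> smooth_fun 1" "\<And>t. t \<ge> 0 \<Longrightarrow> \<phi> t = 0"
    using assms by (auto simp: flat_def)
  obtain \<psi> where \<psi>: "(\<lambda>x. \<psi> (x 0)) \<in> smooth_fun 1" "\<And>t. (\<phi> has_real_derivative \<psi> t) (at t)"
    using smooth_univariate_deriv[OF \<phi>(1)] by blast
  have "\<psi> t = 0" if "t \<ge> 0" for t
  proof -
    have "((\<lambda>s. (\<phi> s - \<phi> t) / (s - t)) \<longlongrightarrow> \<psi> t) (at_right t)"
      using \<psi>(2)[of t] by (simp add: has_field_derivative_iff filterlim_at_split)
    moreover have "((\<lambda>s. (\<phi> s - \<phi> t) / (s - t)) \<longlongrightarrow> 0) (at_right t)"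
      using that by (intro Lim_transform_eventually[OF tendsto_const])
        (auto simp: eventually_at_filter \<phi>(2))
    ultimately show ?thesis
      by (intro tendsto_unique) auto
  qed
  with \<psi> show ?thesis by (intro that[of \<psi>]) (auto simp: flat_def)
qed

text \<open>Induction on \<open>m\<close>: the mean value theorem between \<open>t\<close> and
  \<open>0\<close> turns the bound for the derivative, which is again flat, into a bound with one
  more factor \<open>\<bar>t\<bar>\<close>. The base case is compactness.\<close>

lemma flat_bound:
  assumes "\<phi> \<in> flat"
  shows "\<exists>C. \<forall>t\<in>{-1..0}. \<bar>\<phi> t\<bar> \<le> C * \<bar>t\<bar> ^ m"
  using assms
proof (induction m arbitrary: \<phi>)
  case 0
  obtain \<psi> where \<psi>: "\<And>t. (\<phi> has_real_derivative \<psi> t) (at t)"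
    using flat_deriv[OF 0] by blast
  have "continuous_on {-1..0} \<phi>"
    using DERIV_isCont[OF \<psi>] by (simp add: continuous_at_imp_continuous_on)
  then have "bounded (\<phi> ` {-1..0})"
    by (intro compact_imp_bounded compact_continuous_image) auto
  then show ?case
    by (auto simp: bounded_iff)
next
  case (Suc m)
  obtain \<psi> where \<psi>: "\<psi> \<in> flat" "\<And>t. (\<phi> has_real_derivative \<psi> t) (at t)"
    using flat_deriv[OF Suc.prems] by blast
  obtain C where C: "\<And>t. t \<in> {-1..0} \<Longrightarrow> \<bar>\<psi> t\<bar> \<le> C * \<bar>t\<bar> ^ m"
    using Suc.IH[OF \<psi>(1)] by blast
  \<comment> \<open>At \<open>-1\<close> the power is \<open>1\<close>, so the bound itself forces
    \<open>C\<close> to be nonnegative, as monotonicity requires below.\<close>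
  have "C * \<bar>-1\<bar> ^ m \<ge> 0"
    using C[of "-1"] abs_ge_zero[of "\<psi> (-1)"] by simp
  then have C0: "C \<ge> 0" by simp
  have "\<bar>\<phi> t\<bar> \<le> C * \<bar>t\<bar> ^ Suc m" if t: "t \<in> {-1..0}" for t
  proof (cases "t = 0")
    case True
    then show ?thesis using Suc.prems by (simp add: flat_def)
  next
    case False
    with t have "t < 0" by simp
    then obtain z where z: "t < z" "z < 0" "\<phi> 0 - \<phi> t = (0 - t) * \<psi> z"
      using MVT2[of t 0 \<phi> \<psi>] \<psi>(2) by blast
    have "\<bar>\<phi> t\<bar> = \<bar>t\<bar> * \<bar>\<psi> z\<bar>"
      using z(3) Suc.prems by (simp add: flat_def abs_mult)
    also have "\<dots> \<le> \<bar>t\<bar> * (C * \<bar>t\<bar> ^ m)"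
    proof (rule mult_left_mono)
      have "\<bar>\<psi> z\<bar> \<le> C * \<bar>z\<bar> ^ m"
        using C z t by simp
      also have "\<dots> \<le> C * \<bar>t\<bar> ^ m"
        using z C0 by (intro mult_left_mono power_mono) auto
      finally show "\<bar>\<psi> z\<bar> \<le> C * \<bar>t\<bar> ^ m" .
    qed simp
    finally show ?thesis
      by (simp add: mult.left_commute)
  qed
  then show ?case by blast
qed

text \<open>The derivative of such a quotient is a combination of quotients of the same kind, by
  \<open>t ^ k\<close> and \<open>t ^ (k + 1)\<close>, and \<open>flat_bound\<close> controls the
  behaviour at \<open>0\<close>.\<close>

lemma flat_divide_power:
  assumes "\<phi> \<in> flat"
  shows "(\<lambda>t. \<phi> t / t ^ k) \<in> flat"
proof -
  define q where "q \<phi> k t = (if t < 0 then \<phi> t / t ^ k else 0)" for \<phi> k and t :: real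
  define B where "B = {q \<phi> k | \<phi> k. \<phi> \<in> flat}"
  let ?B = "(\<lambda>\<phi> x. \<phi> (x 0)) ` B :: ((nat \<Rightarrow> real) \<Rightarrow> real) set"
  have "(\<lambda>x. q \<phi> k (x 0)) \<in> smooth_fun 1"
  proof (rule smooth_univariate_family[of B])
    show "q \<phi> k \<in> B" using assms by (auto simp: B_def)
  next
    fix \<theta> assume "\<theta> \<in> B"
    then obtain \<phi> k where \<theta>: "\<theta> = q \<phi> k" and \<phi>: "\<phi> \<in> flat"
      by (auto simp: B_def)
    obtain \<phi>' where \<phi>': "\<phi>' \<in> flat" "\<And>t. (\<phi> has_real_derivative \<phi>' t) (at t)"
      using flat_deriv[OF \<phi>] by blast
    define \<psi> where "\<psi> t = q \<phi>' k t + (- real k) * q \<phi> (k + 1) t" for t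
    have "(\<theta> has_real_derivative \<psi> t) (at t)" for t
      unfolding \<theta> q_def [abs_def]
    proof (rule DERIV_zero_extension)
      assume t: "t < 0"
      have "((\<lambda>t. \<phi> t * inverse t ^ k) has_real_derivative \<psi> t) (at t)"
        using t \<phi>'(2)[of t]
        apply (auto intro!: derivative_eq_intros simp: \<psi>_def q_def)
        apply (cases k)
        apply (auto simp: field_simps power2_eq_square)
        done
      then show "((\<lambda>t. \<phi> t / t ^ k) has_real_derivative \<psi> t) (at t)"
        by (simp add: divide_inverse power_inverse)
    next
      \<comment> \<open>The exponent \<open>k + 2\<close> leaves one factor
        \<open>\<bar>t\<bar>\<close> after division by \<open>t ^ k\<close> and by \<open>t\<close>,
        so the quotient tends to \<open>0\<close>.\<close>
      obtain C where C: "\<And>t. t \<in> {-1..0} \<Longrightarrow> \<bar>\<phi> t\<bar> \<le> C * \<bar>t\<bar> ^ (k + 2)"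
        using flat_bound[OF \<phi>] by blast
      have "eventually (\<lambda>t::real. t \<in> {-1<..<0}) (at_left 0)"
        by (rule eventually_at_leftI[of "-1"]) auto
      then have "eventually (\<lambda>t. norm (\<phi> t / t ^ k / t) \<le> C * \<bar>t\<bar>) (at_left 0)"
      proof eventually_elim
        case (elim t)
        then have "\<bar>\<phi> t\<bar> \<le> C * \<bar>t\<bar> ^ (k + 2)" "\<bar>t\<bar> > 0"
          using C[of t] by auto
        then show ?case
          by (simp add: abs_mult power_abs field_simps)
      qed
      moreover have "((\<lambda>t. C * \<bar>t\<bar>) \<longlongrightarrow> 0) (at_left (0::real))"
        by (auto intro!: tendsto_eq_intros)
      ultimately show "((\<lambda>t. \<phi> t / t ^ k / t) \<longlongrightarrow> 0) (at_left 0)"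
        by (rule Lim_null_comparison)
    qed (auto simp: \<psi>_def q_def)
    moreover have "(\<lambda>x. \<psi> (x 0)) \<in> alg ?B"
      unfolding \<psi>_def using \<phi> \<phi>'(1)
      by (intro alg_add alg_mult alg_const; intro alg_base) (auto simp: B_def)
    ultimately show "\<exists>\<psi>. (\<lambda>x. \<psi> (x 0)) \<in> alg ?B \<and> (\<forall>t. (\<theta> has_real_derivative \<psi> t) (at t))"
      by blast
  qed
  \<comment> \<open>On the half-line, \<open>t = 0\<close> included, the right side is
    \<open>0\<close> because its numerator is.\<close>
  moreover have "q \<phi> k = (\<lambda>t. \<phi> t / t ^ k)"
    using assms by (auto simp: q_def flat_def)
  ultimately show ?thesis using assms by (auto simp: flat_def)
qed

section \<open>Units of \<open>C\<^sup>\<infinity>\<close>-rings\<close>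

lemma op_closed:
  assumes "cinf_ring A" "f \<in> smooth_fun n" "\<forall>i<n. xs i \<in> carrier_of A"
  shows "op_of A n f xs \<in> carrier_of A"
  using assms unfolding cinf_ring_def carrier_of_def op_of_def by (cases A) simp

lemma op_cong:
  assumes "cinf_ring A" "f \<in> smooth_fun n" "\<And>i. i < n \<Longrightarrow> xs i = ys i"
  shows "op_of A n f xs = op_of A n f ys"
  using assms unfolding cinf_ring_def carrier_of_def op_of_def by (cases A) simp

lemma op_coord:
  assumes "cinf_ring A" "i < n" "\<forall>i<n. xs i \<in> carrier_of A"
  shows "op_of A n (\<lambda>y. y i) xs = xs i"
  using assms unfolding cinf_ring_def carrier_of_def op_of_def by (cases A) simp

lemma op_compose:
  assumes "cinf_ring A" "f \<in> smooth_fun n" "\<And>j. j < n \<Longrightarrow> g j \<in> smooth_fun m"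
    "\<forall>i<m. xs i \<in> carrier_of A"
  shows "op_of A m (\<lambda>y. f (\<lambda>j. g j y)) xs = op_of A n f (\<lambda>j. op_of A m (g j) xs)"
  using assms unfolding cinf_ring_def carrier_of_def op_of_def by (cases A) simp

lemma op_unary:
  assumes "cinf_ring A" "(\<lambda>x. \<phi> (x 0)) \<in> smooth_fun 1" "f \<in> smooth_fun n"
    "\<forall>i<n. xs i \<in> carrier_of A"
  shows "op_of A n (\<lambda>y. \<phi> (f y)) xs = op_of A 1 (\<lambda>x. \<phi> (x 0)) (\<lambda>_. op_of A n f xs)"
  using op_compose[OF assms(1,2), of "\<lambda>_. f" n xs] assms(3,4) by simp

lemma op_const:
  assumes "cinf_ring A" "\<forall>i<n. xs i \<in> carrier_of A"
  shows "op_of A n (\<lambda>_. c) xs = cscal A c"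
proof -
  have "op_of A n (\<lambda>_. c) xs = op_of A 0 (\<lambda>_. c) (\<lambda>j. op_of A n (\<lambda>_. c) xs)"
    using op_compose[OF assms(1), of "\<lambda>_. c" 0 "\<lambda>_ _. c" n xs] assms(2) by simp
  also have "\<dots> = cscal A c"
    unfolding cscal_def by (rule op_cong[OF assms(1)]) auto
  finally show ?thesis .
qed

lemma czero_eq_cscal: "czero A = cscal A 0" and cone_eq_cscal: "cone A = cscal A 1"
  by (simp_all add: czero_def cone_def cscal_def)

lemma cscal_closed [simp]: "cinf_ring A \<Longrightarrow> cscal A c \<in> carrier_of A"
  unfolding cscal_def by (rule op_closed) auto

lemma op_add:
  assumes "cinf_ring A" "f \<in> smooth_fun n" "g \<in> smooth_fun n"
    "\<forall>i<n. xs i \<in> carrier_of A"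
  shows "op_of A n (\<lambda>y. f y + g y) xs = cadd A (op_of A n f xs) (op_of A n g xs)"
proof -
  let ?h = "\<lambda>j. if j = (0::nat) then f else g"
  have s: "(\<lambda>v. v 0 + v 1) \<in> smooth_fun 2" by simp
  have "op_of A n (\<lambda>y. f y + g y) xs = op_of A 2 (\<lambda>v. v 0 + v 1) (\<lambda>j. op_of A n (?h j) xs)"
    using op_compose[OF assms(1) s, of ?h n xs] assms by simp
  also have "\<dots> = cadd A (op_of A n f xs) (op_of A n g xs)"
    unfolding cadd_def by (rule op_cong[OF assms(1) s]) auto
  finally show ?thesis .
qed

lemma op_mult:
  assumes "cinf_ring A" "f \<in> smooth_fun n" "g \<in> smooth_fun n"
    "\<forall>i<n. xs i \<in> carrier_of A"
  shows "op_of A n (\<lambda>y. f y * g y) xs = cmul A (op_of A n f xs) (op_of A n g xs)"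
proof -
  let ?h = "\<lambda>j. if j = (0::nat) then f else g"
  have s: "(\<lambda>v. v 0 * v 1) \<in> smooth_fun 2" by simp
  have "op_of A n (\<lambda>y. f y * g y) xs = op_of A 2 (\<lambda>v. v 0 * v 1) (\<lambda>j. op_of A n (?h j) xs)"
    using op_compose[OF assms(1) s, of ?h n xs] assms by simp
  also have "\<dots> = cmul A (op_of A n f xs) (op_of A n g xs)"
    unfolding cmul_def by (rule op_cong[OF assms(1) s]) auto
  finally show ?thesis .
qed

text \<open>Functions whose value at \<open>xs\<close> is zero form an ideal. Identities between
  real functions modulo a relation thus become equations in the ring.\<close>

lemma op_eq_if_diff_multiple:
  assumes A: "cinf_ring A" and xs: "\<forall>i<n. xs i \<in> carrier_of A"
    and sm: "G \<in> smooth_fun n" "P \<in> smooth_fun n" "K \<in> smooth_fun n"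
    and P: "op_of A n P xs = czero A"
    and F: "\<And>y. F y = G y + P y * K y"
  shows "op_of A n F xs = op_of A n G xs"
proof -
  have "op_of A n F xs = op_of A n (\<lambda>y. G y + P y * K y) xs"
    by (rule arg_cong[where f = "\<lambda>F. op_of A n F xs"]) (auto simp: F)
  also have "\<dots> = cadd A (op_of A n G xs) (cmul A (czero A) (op_of A n K xs))"
    using sm by (simp add: op_add[OF A _ _ xs] op_mult[OF A _ _ xs] P)
  also have "\<dots> = op_of A n (\<lambda>y. G y + 0 * K y) xs"
    using op_const[OF A xs, of 0]
    by (subst op_add[OF A _ _ xs]; (subst op_mult[OF A _ _ xs])?) (use sm in \<open>auto simp: czero_eq_cscal\<close>)
  finally show ?thesis by simp
qed

lemma cmul_closed:
  assumes "cinf_ring A" "x \<in> carrier_of A" "y \<in> carrier_of A"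
  shows "cmul A x y \<in> carrier_of A"
  unfolding cmul_def by (rule op_closed) (use assms in auto)

section \<open>Homomorphisms\<close>

lemma hom_closed: "cinf_hom A B h \<Longrightarrow> x \<in> carrier_of A \<Longrightarrow> h x \<in> carrier_of B"
  by (simp add: cinf_hom_def)

lemma hom_op:
  assumes "cinf_hom A B h" "f \<in> smooth_fun n" "\<forall>i<n. xs i \<in> carrier_of A"
  shows "h (op_of A n f xs) = op_of B n f (\<lambda>i. h (xs i))"
  using assms unfolding cinf_hom_def comp_def by blast

lemma hom_cadd:
  assumes "cinf_hom A B h" "cinf_ring B" "x \<in> carrier_of A" "y \<in> carrier_of A"
  shows "h (cadd A x y) = cadd B (h x) (h y)"
  unfolding cadd_def
  by (subst hom_op[OF assms(1)]) (use assms in \<open>auto intro!: op_cong\<close>)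

lemma hom_cmul:
  assumes "cinf_hom A B h" "cinf_ring B" "x \<in> carrier_of A" "y \<in> carrier_of A"
  shows "h (cmul A x y) = cmul B (h x) (h y)"
  unfolding cmul_def
  by (subst hom_op[OF assms(1)]) (use assms in \<open>auto intro!: op_cong\<close>)

lemma hom_cscal:
  assumes "cinf_hom A B h" "cinf_ring B" shows "h (cscal A c) = cscal B c"
  unfolding cscal_def
  by (subst hom_op[OF assms(1)]) (use assms in \<open>auto intro!: op_cong\<close>)

lemma hom_compose:
  assumes "cinf_hom A B h" "cinf_hom B C k"
  shows "cinf_hom A C (\<lambda>x. k (h x))"
  using assms unfolding cinf_hom_def comp_def by simp

section \<open>Exponential elements\<close>

definition cexp :: "'c cinf \<Rightarrow> 'c \<Rightarrow> 'c" where
  "cexp A c = op_of A 1 (\<lambda>x. exp (x 0)) (\<lambda>_. c)"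

text \<open>The elements with a logarithm: a description of positive units free of the zigzags in
  \<open>pi0_eq\<close>. Over objects of the site it turns out to be \<open>Uplus\<close>.\<close>

definition expset :: "'c cinf \<Rightarrow> 'c set" where
  "expset A = cexp A ` carrier_of A"

text \<open>A positive smooth function has a smooth logarithm, and evaluation commutes with
  \<open>exp\<close>. This is how positivity of real functions enters the ring.\<close>

lemma op_in_expset:
  assumes "cinf_ring A" "G \<in> smooth_fun n" "\<And>x. G x > 0"
    "\<forall>i<n. xs i \<in> carrier_of A"
  shows "op_of A n G xs \<in> expset A"
proof -
  have l: "(\<lambda>y. ln (G y)) \<in> smooth_fun n"
    using assms(2,3) by (rule smooth_ln_inverse)
  have "cexp A (op_of A n (\<lambda>y. ln (G y)) xs) = op_of A n (\<lambda>y. exp (ln (G y))) xs"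
    unfolding cexp_def by (rule op_unary[symmetric, OF assms(1) _ l assms(4)]) auto
  also have "\<dots> = op_of A n G xs"
    using assms(3) by simp
  finally show ?thesis
    unfolding expset_def using op_closed[OF assms(1) l assms(4)] by (metis image_eqI)
qed

lemma expset_subset_carrier: "cinf_ring A \<Longrightarrow> expset A \<subseteq> carrier_of A"
  unfolding expset_def cexp_def by (auto intro!: op_closed)

lemma expset_subset_cunits:
  assumes A: "cinf_ring A" shows "expset A \<subseteq> cunits A"
proof
  fix u assume u: "u \<in> expset A"
  then obtain c where c: "c \<in> carrier_of A" and uc: "u = cexp A c"
    by (auto simp: expset_def)
  let ?v = "op_of A 1 (\<lambda>x. exp (- x 0)) (\<lambda>_. c)"
  have "?v \<in> carrier_of A"
    by (rule op_closed[OF A]) (use c in auto)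
  moreover have "cmul A u ?v = op_of A 1 (\<lambda>x. exp (x 0) * exp (- x 0)) (\<lambda>_. c)"
    unfolding uc cexp_def by (rule op_mult[symmetric, OF A]) (use c in auto)
  then have "cmul A u ?v = cone A"
    using c by (simp add: cone_eq_cscal op_const[OF A] flip: exp_add)
  ultimately show "u \<in> cunits A"
    using u expset_subset_carrier[OF A] by (auto simp: cunits_def)
qed

text \<open>Writing both arguments as exponentials turns \<open>G\<close>, positive on the open
  quadrant, into a function of the two logarithms that is positive everywhere.\<close>

lemma cexp_binary_in_expset:
  assumes A: "cinf_ring A" and G: "G \<in> smooth_fun 2" "\<And>x. x 0 > 0 \<Longrightarrow> x 1 > 0 \<Longrightarrow> G x > 0"
    and "u \<in> expset A" "v \<in> expset A"
  shows "op_of A 2 G (\<lambda>i. if i = 0 then u else v) \<in> expset A"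
proof -
  obtain a b where ab: "a \<in> carrier_of A" "b \<in> carrier_of A" and u: "u = cexp A a" and v: "v = cexp A b"
    using assms by (auto simp: expset_def)
  let ?xs = "(!) [a, b]"
  have xs: "\<forall>i<2. ?xs i \<in> carrier_of A"
    using ab by (auto simp: less_Suc_eq numeral_2_eq_2)
  have *: "cexp A (?xs j) = op_of A 2 (\<lambda>x. exp (x j)) ?xs" if "j < 2" for j
  proof -
    have "op_of A 2 (\<lambda>x. exp (x j)) ?xs = cexp A (op_of A 2 (\<lambda>x. x j) ?xs)"
      unfolding cexp_def by (rule op_unary[OF A _ _ xs]) (use that in auto)
    then show ?thesis using op_coord[OF A that xs] by simp
  qed
  have "op_of A 2 (\<lambda>y. G (\<lambda>j. exp (y j))) ?xs \<in> expset A"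
    by (rule op_in_expset[OF A _ _ xs]) (use G in \<open>auto intro: smooth_compose\<close>)
  also have "op_of A 2 (\<lambda>y. G (\<lambda>j. exp (y j))) ?xs = op_of A 2 G (\<lambda>j. op_of A 2 (\<lambda>y. exp (y j)) ?xs)"
    by (rule op_compose[OF A G(1) _ xs]) auto
  also have "\<dots> = op_of A 2 G (\<lambda>i. if i = 0 then u else v)"
    using *[of 0] *[of 1] by (intro op_cong[OF A G(1)]) (auto simp: u v less_Suc_eq numeral_2_eq_2)
  finally show ?thesis .
qed

lemma cadd_in_expset:
  "cinf_ring A \<Longrightarrow> u \<in> expset A \<Longrightarrow> v \<in> expset A \<Longrightarrow> cadd A u v \<in> expset A"
  unfolding cadd_def by (rule cexp_binary_in_expset) auto

lemma cmul_in_expset: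
  "cinf_ring A \<Longrightarrow> u \<in> expset A \<Longrightarrow> v \<in> expset A \<Longrightarrow> cmul A u v \<in> expset A"
  unfolding cmul_def by (rule cexp_binary_in_expset) auto

lemma hom_expset:
  assumes "cinf_hom A B h" "u \<in> expset A" shows "h u \<in> expset B"
proof -
  obtain c where c: "c \<in> carrier_of A" "u = cexp A c"
    using assms by (auto simp: expset_def)
  then have "h u = cexp B (h c)"
    unfolding cexp_def by (simp add: hom_op[OF assms(1)])
  then show ?thesis
    using c hom_closed[OF assms(1)] by (auto simp: expset_def)
qed

lemma cmul_cone:
  assumes A: "cinf_ring A" and x: "x \<in> carrier_of A"
  shows "cmul A x (cone A) = x"
proof -
  have "op_of A 1 (\<lambda>y. y 0 * 1) (\<lambda>_. x) = cmul A (op_of A 1 (\<lambda>y. y 0) (\<lambda>_. x)) (op_of A 1 (\<lambda>_. 1) (\<lambda>_. x))"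
    by (rule op_mult[OF A]) (use x in auto)
  then show ?thesis
    using x by (simp add: op_coord[OF A] op_const[OF A] cone_eq_cscal)
qed

lemma cmul_czero:
  assumes A: "cinf_ring A" and x: "x \<in> carrier_of A"
  shows "cmul A x (czero A) = czero A"
proof -
  have "op_of A 1 (\<lambda>y. y 0 * 0) (\<lambda>_. x) = cmul A (op_of A 1 (\<lambda>y. y 0) (\<lambda>_. x)) (op_of A 1 (\<lambda>_. 0) (\<lambda>_. x))"
    by (rule op_mult[OF A]) (use x in auto)
  then show ?thesis
    using x by (simp add: op_coord[OF A] op_const[OF A] czero_eq_cscal)
qed

section \<open>Connected rings and the sign of a unit\<close>

lemma czero_neq_cone:
  assumes A: "cinf_ring A" and card: "card (cidempotents A) = 2"
  shows "czero A \<noteq> cone A"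
proof
  assume eq: "czero A = cone A"
  have "cidempotents A \<subseteq> {czero A}"
    using cmul_cone[OF A] cmul_czero[OF A] eq by (auto simp: cidempotents_def)
  then have "card (cidempotents A) \<le> card {czero A}"
    by (intro card_mono) auto
  then show False using card by simp
qed

lemma cidempotents_trivial:
  assumes A: "cinf_ring A" and card: "card (cidempotents A) = 2"
  shows "cidempotents A = {czero A, cone A}"
proof -
  have "cone A \<in> carrier_of A" "czero A \<in> carrier_of A"
    using A by (auto simp: czero_eq_cscal cone_eq_cscal)
  then have "{czero A, cone A} \<subseteq> cidempotents A"
    using cmul_cone[OF A] cmul_czero[OF A] by (auto simp: cidempotents_def)
  moreover have "card {czero A, cone A} = 2"
    using czero_neq_cone[OF assms] by simp
  moreover have "finite (cidempotents A)"
    using card by (intro card_ge_0_finite) simp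
  ultimately show ?thesis
    using card card_subset_eq by metis
qed

text \<open>A unit with its inverse is a point of the hyperbola \<open>x 0 * x 1 = 1\<close>. The
  function \<open>e\<close> is \<open>1\<close> on its positive branch and \<open>0\<close> on the
  negative one, and a connected ring sees only one branch.\<close>

lemma cunits_expset_dichotomy:
  assumes A: "cinf_ring A" and card: "card (cidempotents A) = 2" and u: "u \<in> cunits A"
  shows "u \<in> expset A \<or> cmul A (cscal A (-1)) u \<in> expset A"
proof -
  obtain v where uv: "u \<in> carrier_of A" "v \<in> carrier_of A" "cmul A u v = cone A"
    using u by (auto simp: cunits_def)
  let ?xs = "(!) [u, v]"
  have xs: "\<forall>i<2. ?xs i \<in> carrier_of A"
    using uv by (auto simp: less_Suc_eq numeral_2_eq_2)
  have xs0: "op_of A 2 (\<lambda>x. x 0) ?xs = u" and xs1: "op_of A 2 (\<lambda>x. x 1) ?xs = v"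
    using op_coord[OF A _ xs] by force+
  \<comment> \<open>On the hyperbola \<open>r x\<close> equals \<open>\<bar>x 0 + x 1\<bar>\<close>;
    in this form it is smooth and positive on the whole plane.\<close>
  define r :: "(nat \<Rightarrow> real) \<Rightarrow> real" where "r x = sqrt ((x 0 - x 1)\<^sup>2 + 4)" for x
  define e where "e x = (1 + (x 0 + x 1) / r x) * (1 / 2)" for x
  have r: "r x > 0" "r x * r x = (x 0 - x 1)\<^sup>2 + 4" for x
    unfolding r_def by (auto intro: add_nonneg_pos simp flip: power2_eq_square)
  have sr: "r \<in> smooth_fun 2"
    unfolding r_def [abs_def] by (intro smooth_sqrt) (auto intro: add_nonneg_pos)
  have se: "e \<in> smooth_fun 2"
    unfolding e_def [abs_def] by (intro smooth_mult smooth_add smooth_divide sr r) auto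
  have si: "(\<lambda>x. 1 / (r x * r x)) \<in> smooth_fun 2"
    by (intro smooth_divide smooth_mult sr) (use r(1) in auto)
  have P: "op_of A 2 (\<lambda>x. x 0 * x 1 + (- 1)) ?xs = czero A"
  proof -
    have "op_of A 2 (\<lambda>x. x 0 * x 1 + (- 1)) ?xs = cadd A (cone A) (cscal A (-1))"
      using op_add[OF A _ _ xs, of "\<lambda>x. x 0 * x 1" "\<lambda>_. -1"] op_mult[OF A _ _ xs, of "\<lambda>x. x 0" "\<lambda>x. x 1"]
        op_const[OF A xs] uv xs0 xs1 by simp
    also have "\<dots> = op_of A 2 (\<lambda>_. 1 + (-1)) ?xs"
      using op_add[OF A _ _ xs, of "\<lambda>x. 1" "\<lambda>_. -1"] op_const[OF A xs] by (simp add: cone_eq_cscal)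
    also have "\<dots> = czero A"
      using op_const[OF A xs] by (simp add: czero_eq_cscal)
    finally show ?thesis .
  qed
  \<comment> \<open>The defect of idempotence is the relation \<open>x 0 * x 1 - 1\<close> times the
    smooth function \<open>1 / (r x * r x)\<close>, so it vanishes at \<open>u\<close> and
    \<open>v\<close>.\<close>
  have "e x * e x = e x + (x 0 * x 1 + (- 1)) * (1 / (r x * r x))" for x
  proof -
    have "(x 0 + x 1) * (x 0 + x 1) = r x * r x + 4 * (x 0 * x 1 + (- 1))"
      unfolding r by (simp add: power2_eq_square algebra_simps)
    then have "((x 0 + x 1) / r x) * ((x 0 + x 1) / r x) = (r x * r x + 4 * (x 0 * x 1 + (- 1))) / (r x * r x)"
      by (simp only: times_divide_times_eq)
    also have "\<dots> = 1 + 4 * ((x 0 * x 1 + (- 1)) * (1 / (r x * r x)))"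
      using r(1)[of x] by (simp add: add_divide_distrib)
    finally have "((x 0 + x 1) / r x) * ((x 0 + x 1) / r x) =
        1 + 4 * ((x 0 * x 1 + (- 1)) * (1 / (r x * r x)))" .
    then show ?thesis
      unfolding e_def by algebra
  qed
  then have "op_of A 2 (\<lambda>x. e x * e x) ?xs = op_of A 2 e ?xs"
    by (intro op_eq_if_diff_multiple[OF A xs se _ si P]) auto
  then have "op_of A 2 e ?xs \<in> cidempotents A"
    using op_mult[OF A se se xs] op_closed[OF A se xs] by (simp add: cidempotents_def)
  then consider "op_of A 2 e ?xs = cone A" | "op_of A 2 e ?xs = czero A"
    using cidempotents_trivial[OF A card] by blast
  then show ?thesis
  proof cases
    case 1
    \<comment> \<open>If \<open>e\<close> is \<open>1\<close>, then \<open>x 0 + x 1 = r\<close>, so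
      \<open>x 0\<close> is half of \<open>(x 0 - x 1) + r\<close>, which is positive on the whole
      plane.\<close>
    let ?Q = "\<lambda>x. (x 0 - x 1 + r x) * (1 / 2)"
    have sQ: "?Q \<in> smooth_fun 2"
      using sr by (intro smooth_mult smooth_add smooth_diff) auto
    have Qpos: "?Q x > 0" for x
    proof -
      have "\<bar>x 0 - x 1\<bar> < r x"
        unfolding r_def by (intro real_less_rsqrt) auto
      then show ?thesis by auto
    qed
    have P: "op_of A 2 (\<lambda>x. e x + (- 1)) ?xs = czero A"
      using op_add[OF A se smooth_const xs, of "-1"] op_add[OF A smooth_const smooth_const xs, of 1 "-1"]
        op_const[OF A xs] 1 by (simp add: cone_eq_cscal czero_eq_cscal)
    have "x 0 = ?Q x + (e x + (- 1)) * r x" for x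
      using r(1)[of x] by (simp add: e_def field_simps)
    then have "op_of A 2 (\<lambda>x. x 0) ?xs = op_of A 2 ?Q ?xs"
      using se by (intro op_eq_if_diff_multiple[OF A xs sQ _ sr P]) auto
    moreover have "op_of A 2 ?Q ?xs \<in> expset A"
      by (rule op_in_expset[OF A sQ Qpos xs])
    ultimately show ?thesis using xs0 by simp
  next
    case 2
    \<comment> \<open>If \<open>e\<close> is \<open>0\<close>, then \<open>x 0 + x 1 = - r\<close>,
      and the same computation describes \<open>- x 0\<close>.\<close>
    let ?Q = "\<lambda>x. (x 1 - x 0 + r x) * (1 / 2)"
    have sQ: "?Q \<in> smooth_fun 2"
      using sr by (intro smooth_mult smooth_add smooth_diff) auto
    have Qpos: "?Q x > 0" for x
    proof -
      have "\<bar>x 0 - x 1\<bar> < r x"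
        unfolding r_def by (intro real_less_rsqrt) auto
      then show ?thesis by auto
    qed
    have "(- 1) * x 0 = ?Q x + e x * (- r x)" for x
      using r(1)[of x] by (simp add: e_def field_simps)
    then have "op_of A 2 (\<lambda>x. (- 1) * x 0) ?xs = op_of A 2 ?Q ?xs"
      using sQ sr se by (intro op_eq_if_diff_multiple[OF A xs sQ se smooth_uminus[OF sr] 2]) auto
    moreover have "op_of A 2 ?Q ?xs \<in> expset A"
      by (rule op_in_expset[OF A sQ Qpos xs])
    moreover have "op_of A 2 (\<lambda>x. (- 1) * x 0) ?xs = cmul A (cscal A (-1)) u"
      using op_mult[OF A _ _ xs, of "\<lambda>_. -1" "\<lambda>x. x 0"] op_const[OF A xs] xs0 by simp
    ultimately show ?thesis by simp
  qed
qed

text \<open>Otherwise \<open>0 = u + (- u)\<close> would be a sum of exponentials and therefore a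
  unit, forcing \<open>0 = 1\<close>.\<close>

lemma expset_neg_disjoint:
  assumes A: "cinf_ring A" and nontriv: "czero A \<noteq> cone A" and u: "u \<in> expset A"
  shows "cmul A (cscal A (-1)) u \<notin> expset A"
proof
  assume "cmul A (cscal A (-1)) u \<in> expset A"
  then have *: "cadd A u (cmul A (cscal A (-1)) u) \<in> expset A"
    using cadd_in_expset[OF A u] by blast
  have uc: "u \<in> carrier_of A" using u expset_subset_carrier[OF A] by blast
  have "op_of A 1 (\<lambda>x. x 0 + (-1) * x 0) (\<lambda>_. u) = cadd A u (cmul A (cscal A (-1)) u)"
    using uc op_add[OF A, of "\<lambda>x. x 0" 1 "\<lambda>x. (-1) * x 0" "\<lambda>_. u"]
      op_mult[OF A, of "\<lambda>_. -1" 1 "\<lambda>x. x 0" "\<lambda>_. u"] op_const[OF A, of 1 "\<lambda>_. u"]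
      op_coord[OF A, of 0 1 "\<lambda>_. u"] by simp
  then have "cadd A u (cmul A (cscal A (-1)) u) = czero A"
    using uc op_const[OF A, of 1 "\<lambda>_. u"] by (simp add: czero_eq_cscal)
  with * have "czero A \<in> cunits A"
    using expset_subset_cunits[OF A] by auto
  then obtain v where v: "v \<in> carrier_of A" "cmul A (czero A) v = cone A"
    by (auto simp: cunits_def)
  have "op_of A 1 (\<lambda>x. 0 * x 0) (\<lambda>_. v) = cmul A (czero A) v"
    using v op_mult[OF A, of "\<lambda>_. 0" 1 "\<lambda>x. x 0" "\<lambda>_. v"] op_const[OF A, of 1 "\<lambda>_. v"]
      op_coord[OF A, of 0 1 "\<lambda>_. v"] by (simp add: czero_eq_cscal)
  then show False
    using v nontriv op_const[OF A, of 1 "\<lambda>_. v"] by (simp add: czero_eq_cscal)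
qed

section \<open>The smooth line and the components of the unit group\<close>

text \<open>Reals are stored as constant sequences, since \<open>W_determined\<close> quantifies
  over Weil algebras carried by \<open>nat \<Rightarrow> real\<close>.\<close>

definition weil_real :: obj where
  "weil_real = (range (\<lambda>c _. c), \<lambda>n f xs _. f (\<lambda>i. xs i 0))"

lemma carrier_weil_real: "carrier_of weil_real = range (\<lambda>c _. c)"
  and op_weil_real: "op_of weil_real n f xs = (\<lambda>_. f (\<lambda>i. xs i 0))"
  by (simp_all add: weil_real_def carrier_of_def op_of_def)

lemma cinf_ring_weil_real: "cinf_ring weil_real"
  unfolding cinf_ring_def weil_real_def prod.case
proof (intro conjI allI impI)
  fix n f and xs ys :: "nat \<Rightarrow> nat \<Rightarrow> real"
  assume "f \<in> smooth_fun n \<and> (\<forall>i<n. xs i = ys i)"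
  then have "f (\<lambda>i. xs i 0) = f (\<lambda>i. ys i 0)"
    by (intro smooth_fun_cong[of f n]) auto
  then show "(\<lambda>_::nat. f (\<lambda>i. xs i 0)) = (\<lambda>_. f (\<lambda>i. ys i 0))" by simp
next
  fix n i and xs :: "nat \<Rightarrow> nat \<Rightarrow> real"
  assume "i < n \<and> (\<forall>j<n. xs j \<in> range (\<lambda>c _. c))"
  then have "xs i \<in> range (\<lambda>c _. c)" by blast
  then show "(\<lambda>_. xs i 0) = xs i" by auto
qed auto

lemma weil_algebra_weil_real: "weil_algebra weil_real"
  unfolding weil_algebra_def
proof (intro conjI)
  have "\<forall>w\<in>carrier_of weil_real. \<exists>c. w = op_of weil_real 1 (\<lambda>y. \<Sum>i<1. c i * y i) (\<lambda>_ _. 1)"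
  proof
    fix w assume "w \<in> carrier_of weil_real"
    then obtain d where "w = (\<lambda>_. d)" by (auto simp: carrier_weil_real)
    then show "\<exists>c. w = op_of weil_real 1 (\<lambda>y. \<Sum>i<1. c i * y i) (\<lambda>_ _. 1)"
      by (intro exI[of _ "\<lambda>_. d"]) (simp add: op_weil_real)
  qed
  then show "\<exists>k e. (\<forall>i<k. e i \<in> carrier_of weil_real) \<and>
      (\<forall>w\<in>carrier_of weil_real. \<exists>c. w = op_of weil_real k (\<lambda>y. \<Sum>i<k. c i * y i) e)"
    by (intro exI[of _ "1::nat"] exI[of _ "\<lambda>_ _. 1"]) (auto simp: carrier_weil_real)
  have "\<exists>!(c, n). n \<in> {\<lambda>_. 0} \<and> w = cadd weil_real (cscal weil_real c) n"
    if "w \<in> carrier_of weil_real" for w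
    using that by (auto simp: carrier_weil_real cadd_def cscal_def op_weil_real fun_eq_iff)
  moreover have "\<exists>k>0. \<forall>xs. (\<forall>i<k. xs i \<in> {\<lambda>_. 0}) \<longrightarrow>
      op_of weil_real k (\<lambda>y. \<Prod>i<k. y i) xs = czero weil_real"
    by (intro exI[of _ "1::nat"]) (simp add: czero_def op_weil_real)
  ultimately show "\<exists>N\<subseteq>carrier_of weil_real. czero weil_real \<in> N \<and>
      (\<forall>x\<in>N. \<forall>y\<in>N. cadd weil_real x y \<in> N) \<and>
      (\<forall>x\<in>N. \<forall>w\<in>carrier_of weil_real. cmul weil_real w x \<in> N) \<and>
      (\<exists>k>0. \<forall>xs. (\<forall>i<k. xs i \<in> N) \<longrightarrow>
        op_of weil_real k (\<lambda>y. \<Prod>i<k. y i) xs = czero weil_real) \<and>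
      (\<forall>w\<in>carrier_of weil_real. \<exists>!(c, n). n \<in> N \<and> w = cadd weil_real (cscal weil_real c) n)"
    by (intro exI[of _ "{\<lambda>_. 0}"] conjI)
      (auto simp: carrier_weil_real cadd_def cmul_def czero_def op_weil_real)
qed (rule cinf_ring_weil_real)

text \<open>A continuous function is determined by its values on \<open>\<rat>\<close>, which fits \<open>C\<^sup>\<infinity>(\<real>)\<close> into the
carrier type \<open>nat \<Rightarrow> real\<close>.\<close>

definition encode :: "((nat \<Rightarrow> real) \<Rightarrow> real) \<Rightarrow> nat \<Rightarrow> real" where
  "encode f k = f (\<lambda>_. from_nat_into \<rat> k)"

definition decode :: "(nat \<Rightarrow> real) \<Rightarrow> (nat \<Rightarrow> real) \<Rightarrow> real" where
  "decode = inv_into (smooth_fun 1) encode"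

text \<open>A copy of \<open>C\<^sup>\<infinity>(\<real>)\<close>: operations act pointwise on
  functions and are transported along \<open>encode\<close>.\<close>

definition smooth_line :: obj where
  "smooth_line = (encode ` smooth_fun 1, \<lambda>n f xs. encode (\<lambda>x. f (\<lambda>i. decode (xs i) x)))"

lemma smooth_fun_1_isCont:
  assumes "f \<in> smooth_fun 1" shows "isCont (\<lambda>t. f (\<lambda>_. t)) t"
proof -
  have "(\<lambda>x. f (\<lambda>_. x 0)) \<in> smooth_fun 1"
    using assms smooth_fun_1_eq[OF assms, symmetric] by simp
  then show ?thesis
    by (rule smooth_univariate_deriv) (blast intro: DERIV_isCont)
qed

lemma inj_on_encode: "inj_on encode (smooth_fun 1)"
proof (rule inj_onI, rule ext)
  fix f g and x :: "nat \<Rightarrow> real"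
  assume f: "f \<in> smooth_fun 1" and g: "g \<in> smooth_fun 1" and eq: "encode f = encode g"
  have "f (\<lambda>_. q) - g (\<lambda>_. q) = 0" if "q \<in> \<rat>" for q
    using fun_cong[OF eq, of "to_nat_on \<rat> q"] that
    by (simp add: encode_def countable_rat)
  moreover have "continuous_on (closure \<rat>) (\<lambda>t. f (\<lambda>_. t) - g (\<lambda>_. t))"
    using f g by (intro continuous_at_imp_continuous_on ballI continuous_diff smooth_fun_1_isCont)
  ultimately have "f (\<lambda>_. x 0) - g (\<lambda>_. x 0) = 0"
    using continuous_constant_on_closure[of \<rat> "\<lambda>t. f (\<lambda>_. t) - g (\<lambda>_. t)" 0 "x 0"]
    by (simp add: Rats_closure_real)
  then show "f x = g x"
    using smooth_fun_1_eq[OF f, of x] smooth_fun_1_eq[OF g, of x] by simp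
qed

lemma decode_encode [simp]: "f \<in> smooth_fun 1 \<Longrightarrow> decode (encode f) = f"
  unfolding decode_def by (rule inv_into_f_f[OF inj_on_encode])

lemma carrier_smooth_line: "carrier_of smooth_line = encode ` smooth_fun 1"
  and op_smooth_line: "op_of smooth_line n f xs = encode (\<lambda>x. f (\<lambda>i. decode (xs i) x))"
  by (simp_all add: smooth_line_def carrier_of_def op_of_def)

lemma decode_smooth: "x \<in> encode ` smooth_fun 1 \<Longrightarrow> decode x \<in> smooth_fun 1"
  by (erule imageE) simp

lemma decode_op_smooth_line:
  assumes "f \<in> smooth_fun n" "\<forall>i<n. xs i \<in> encode ` smooth_fun 1"
  shows "(\<lambda>x. f (\<lambda>i. decode (xs i) x)) \<in> smooth_fun 1"
  by (rule smooth_compose[OF assms(1), of "\<lambda>i. decode (xs i)"]) (use assms(2) in \<open>blast intro: decode_smooth\<close>)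

lemma cinf_ring_smooth_line: "cinf_ring smooth_line"
  unfolding cinf_ring_def smooth_line_def prod.case
proof (intro conjI allI impI; elim conjE)
  fix n f and xs :: "nat \<Rightarrow> nat \<Rightarrow> real"
  assume "f \<in> smooth_fun n" "\<forall>i<n. xs i \<in> encode ` smooth_fun 1"
  then show "encode (\<lambda>x. f (\<lambda>i. decode (xs i) x)) \<in> encode ` smooth_fun 1"
    by (intro imageI decode_op_smooth_line)
next
  fix n f and xs ys :: "nat \<Rightarrow> nat \<Rightarrow> real"
  assume "f \<in> smooth_fun n" "\<forall>i<n. xs i = ys i"
  then have "f (\<lambda>i. decode (xs i) x) = f (\<lambda>i. decode (ys i) x)" for x
    by (intro smooth_fun_cong[of f n]) auto
  then show "encode (\<lambda>x. f (\<lambda>i. decode (xs i) x)) = encode (\<lambda>x. f (\<lambda>i. decode (ys i) x))"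
    by simp
next
  fix n i and xs :: "nat \<Rightarrow> nat \<Rightarrow> real"
  assume "i < n" "\<forall>j<n. xs j \<in> encode ` smooth_fun 1"
  then have "xs i \<in> encode ` smooth_fun 1" by blast
  then show "encode (\<lambda>x. decode (xs i) x) = xs i" by auto
next
  fix n m f g and xs :: "nat \<Rightarrow> nat \<Rightarrow> real"
  assume f: "f \<in> smooth_fun n" and g: "\<forall>j<n. g j \<in> smooth_fun m" and xs: "\<forall>i<m. xs i \<in> encode ` smooth_fun 1"
  have "f (\<lambda>j. g j (\<lambda>i. decode (xs i) x)) =
      f (\<lambda>j. decode (encode (\<lambda>x. g j (\<lambda>i. decode (xs i) x))) x)" for x
    using decode_op_smooth_line[OF _ xs] g by (intro smooth_fun_cong[OF f]) simp
  then show "encode (\<lambda>x. f (\<lambda>j. g j (\<lambda>i. decode (xs i) x))) =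
      encode (\<lambda>x. f (\<lambda>j. decode (encode (\<lambda>x. g j (\<lambda>i. decode (xs i) x))) x))"
    by simp
qed

lemma hom_smooth_line_weil_real:
  "cinf_hom smooth_line weil_real (\<lambda>s _. decode s (\<lambda>_. t))"
  unfolding cinf_hom_def
proof (intro conjI ballI allI impI; (elim conjE)?)
  fix n f and xs :: "nat \<Rightarrow> nat \<Rightarrow> real"
  assume "f \<in> smooth_fun n" "\<forall>i<n. xs i \<in> carrier_of smooth_line"
  then have "decode (op_of smooth_line n f xs) = (\<lambda>x. f (\<lambda>i. decode (xs i) x))"
    unfolding op_smooth_line by (intro decode_encode decode_op_smooth_line) (auto simp: carrier_smooth_line)
  then show "(\<lambda>_. decode (op_of smooth_line n f xs) (\<lambda>_. t)) =
      op_of weil_real n f ((\<lambda>s _. decode s (\<lambda>_. t)) \<circ> xs)"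
    by (simp add: op_weil_real)
qed (simp add: carrier_weil_real)

lemma hom_weil_real_real_cinf: "cinf_hom weil_real real_cinf (\<lambda>w. w 0)"
  unfolding cinf_hom_def
proof (intro conjI ballI allI impI)
  fix n f and xs :: "nat \<Rightarrow> nat \<Rightarrow> real"
  show "op_of weil_real n f xs 0 = op_of real_cinf n f ((\<lambda>w. w 0) \<circ> xs)"
    by (simp add: op_weil_real comp_def) (simp add: op_of_def real_cinf_def)
qed (simp add: carrier_of_def real_cinf_def)

text \<open>A continuous function on the connected line with values in \<open>{0, 1}\<close> is
  constant.\<close>

lemma smooth_fun_1_idempotent:
  assumes f: "f \<in> smooth_fun 1" and idem: "\<And>x. f x * f x = f x"
  shows "f = (\<lambda>_. 0) \<or> f = (\<lambda>_. 1)"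
proof -
  have val: "f x = 0 \<or> f x = 1" for x
    using idem[of x] by simp
  have "(\<lambda>t. f (\<lambda>_. t)) constant_on UNIV"
  proof (rule continuous_finite_range_constant)
    show "continuous_on UNIV (\<lambda>t. f (\<lambda>_. t))"
      using f by (intro continuous_at_imp_continuous_on ballI smooth_fun_1_isCont)
    show "finite (range (\<lambda>t. f (\<lambda>_. t)))"
      by (rule finite_subset[of _ "{0, 1}"]) (use val in auto)
  qed (rule connected_UNIV)
  then obtain c where "\<And>t. f (\<lambda>_. t) = c"
    by (auto simp: constant_on_def)
  then have "f = (\<lambda>_. c)"
    using smooth_fun_1_eq[OF f] by auto
  then show ?thesis
    using val[of "\<lambda>_. 0"] by auto
qed

lemma card_cidempotents_smooth_line: "card (cidempotents smooth_line) = 2"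
proof -
  have cmul: "cmul smooth_line (encode f) (encode f) = encode (\<lambda>x. f x * f x)" if "f \<in> smooth_fun 1" for f
    using that by (simp add: cmul_def op_smooth_line)
  have "cidempotents smooth_line = {encode (\<lambda>_. 0), encode (\<lambda>_. 1)}"
  proof
    show "cidempotents smooth_line \<subseteq> {encode (\<lambda>_. 0), encode (\<lambda>_. 1)}"
    proof
      fix e assume e: "e \<in> cidempotents smooth_line"
      then obtain f where f: "f \<in> smooth_fun 1" "e = encode f"
        by (auto simp: cidempotents_def carrier_smooth_line)
      then have "encode (\<lambda>x. f x * f x) = encode f"
        using e cmul by (simp add: cidempotents_def)
      then have "(\<lambda>x. f x * f x) = f"
        using inj_on_encode f(1) by (auto dest: inj_onD)
      then have "f = (\<lambda>_. 0) \<or> f = (\<lambda>_. 1)"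
        using f(1) by (intro smooth_fun_1_idempotent) (auto dest: fun_cong)
      then show "e \<in> {encode (\<lambda>_. 0), encode (\<lambda>_. 1)}" using f(2) by auto
    qed
    show "{encode (\<lambda>_. 0), encode (\<lambda>_. 1)} \<subseteq> cidempotents smooth_line"
      by (auto simp: cidempotents_def carrier_smooth_line cmul)
  qed
  moreover have "encode (\<lambda>_. 0) \<noteq> encode (\<lambda>_. 1)"
    by (simp add: encode_def fun_eq_iff)
  ultimately show ?thesis by simp
qed

text \<open>The coordinate function generates, evaluations at real points already separate smooth
  functions, and evaluation at \<open>0\<close> is a point.\<close>

lemma CW_obj_smooth_line: "CW_obj smooth_line"
  unfolding CW_obj_def
proof (intro conjI)
  show "finitely_generated smooth_line"
    unfolding finitely_generated_def
  proof (intro exI conjI ballI allI impI)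
    show "encode (\<lambda>x. x 0) \<in> carrier_of smooth_line"
      by (auto simp: carrier_smooth_line)
  next
    fix s assume "s \<in> carrier_of smooth_line"
    then obtain f where f: "f \<in> smooth_fun 1" "s = encode f"
      by (auto simp: carrier_smooth_line)
    have "s = op_of smooth_line 1 f (\<lambda>_. encode (\<lambda>x. x 0))"
      using f(2) smooth_fun_1_eq[OF f(1), symmetric] by (simp add: op_smooth_line)
    with f(1) show "\<exists>f\<in>smooth_fun 1. s = op_of smooth_line 1 f (\<lambda>_. encode (\<lambda>x. x 0))"
      by (intro bexI[of _ f])
  qed
  show "W_determined smooth_line"
    unfolding W_determined_def
  proof (intro ballI impI)
    fix x y assume x: "x \<in> carrier_of smooth_line" and y: "y \<in> carrier_of smooth_line"
      and eq: "\<forall>(W :: obj) h. weil_algebra W \<and> cinf_hom smooth_line W h \<longrightarrow> h x = h y"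
    obtain f g where f: "f \<in> smooth_fun 1" "x = encode f" and g: "g \<in> smooth_fun 1" "y = encode g"
      using x y by (auto simp: carrier_smooth_line)
    have "f (\<lambda>_. t) = g (\<lambda>_. t)" for t
      using eq[rule_format, of weil_real "\<lambda>s _. decode s (\<lambda>_. t)"]
        weil_algebra_weil_real hom_smooth_line_weil_real[of t] f g by (auto dest: fun_cong)
    then have "f = g"
      using smooth_fun_1_eq[OF f(1)] smooth_fun_1_eq[OF g(1)] by (metis ext)
    then show "x = y" using f g by simp
  qed
  have "cinf_hom smooth_line real_cinf (\<lambda>s. decode s (\<lambda>_. 0))"
    using hom_compose[OF hom_smooth_line_weil_real hom_weil_real_real_cinf] .
  then show "\<exists>h. cinf_hom smooth_line real_cinf h"
    by (intro exI[of _ "\<lambda>s. decode s (\<lambda>_. 0)"])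
qed (rule cinf_ring_smooth_line card_cidempotents_smooth_line)+

text \<open>The universal property of the free ring on one generator: the generator is sent to
  \<open>c\<close>.\<close>

lemma hom_from_smooth_line:
  assumes A: "cinf_ring A" and c: "c \<in> carrier_of A"
  shows "cinf_hom smooth_line A (\<lambda>s. op_of A 1 (decode s) (\<lambda>_. c))"
  unfolding cinf_hom_def
proof (intro conjI ballI allI impI; (elim conjE)?)
  fix s assume "s \<in> carrier_of smooth_line"
  then show "op_of A 1 (decode s) (\<lambda>_. c) \<in> carrier_of A"
    using c by (intro op_closed[OF A]) (auto simp: carrier_smooth_line)
next
  fix n f and xs :: "nat \<Rightarrow> nat \<Rightarrow> real"
  assume f: "f \<in> smooth_fun n" and "\<forall>i<n. xs i \<in> carrier_of smooth_line"
  then have xs: "\<forall>i<n. xs i \<in> encode ` smooth_fun 1" by (simp add: carrier_smooth_line)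
  have "op_of A 1 (decode (op_of smooth_line n f xs)) (\<lambda>_. c) =
      op_of A 1 (\<lambda>x. f (\<lambda>i. decode (xs i) x)) (\<lambda>_. c)"
    using decode_op_smooth_line[OF f xs] by (simp add: op_smooth_line)
  also have "\<dots> = op_of A n f (\<lambda>i. op_of A 1 (decode (xs i)) (\<lambda>_. c))"
    using xs c by (intro op_compose[OF A f]) (auto simp: decode_smooth)
  finally show "op_of A 1 (decode (op_of smooth_line n f xs)) (\<lambda>_. c) =
      op_of A n f ((\<lambda>s. op_of A 1 (decode s) (\<lambda>_. c)) \<circ> xs)"
    by (simp add: comp_def)
qed

section \<open>Components of the unit group\<close>

lemma CW_objD:
  assumes "CW_obj A"
  shows "cinf_ring A" "W_determined A" "card (cidempotents A) = 2" "czero A \<noteq> cone A"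
  using assms czero_neq_cone unfolding CW_obj_def by blast+

text \<open>Homomorphisms preserve exponentials. They also reflect them on units: if
  \<open>u\<close> is not an exponential then \<open>- u\<close> is, and \<open>h u\<close> and
  \<open>- h u\<close> cannot both be exponentials in a nontrivial ring.\<close>

lemma pi0_eq_expset_iff:
  "pi0_eq p q \<Longrightarrow> snd p \<in> expset (fst p) \<longleftrightarrow> snd q \<in> expset (fst q)"
proof (induction rule: pi0_eq.induct)
  case (pi0_step A B h u)
  then have A: "CW_obj A" and B: "CW_obj B" and h: "cinf_hom A B h"
    by (auto simp: CW_hom_def)
  note A' = CW_objD[OF A] and B' = CW_objD[OF B]
  have u: "u \<in> carrier_of A"
    using pi0_step by (simp add: cunits_def)
  have "u \<in> expset A" if hu: "h u \<in> expset B"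
  proof (rule ccontr)
    assume "u \<notin> expset A"
    then have "cmul A (cscal A (-1)) u \<in> expset A"
      using cunits_expset_dichotomy[OF A'(1,3) pi0_step(2)] by blast
    then have "h (cmul A (cscal A (-1)) u) \<in> expset B"
      by (rule hom_expset[OF h])
    then show False
      using expset_neg_disjoint[OF B'(1,4) hu] u A'(1)
      by (simp add: hom_cmul[OF h B'(1)] hom_cscal[OF h B'(1)])
  qed
  then show ?case
    using hom_expset[OF h] by auto
qed auto

text \<open>The zigzag from \<open>exp c\<close> to \<open>1\<close> passes through
  \<open>u0\<close>, which maps to both, as \<open>1 = exp 0\<close>. Conversely,
  \<open>pi0_eq_expset_iff\<close> carries exponentiality from \<open>1\<close> to everything in its
  component.\<close>

lemma Uplus_eq_expset:
  assumes "CW_obj A"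
  shows "Uplus A = expset A"
proof -
  note A = CW_objD(1)[OF assms]
  have L: "CW_hom smooth_line A (\<lambda>s. op_of A 1 (decode s) (\<lambda>_. c))" if "c \<in> carrier_of A" for c
    using that assms CW_obj_smooth_line hom_from_smooth_line[OF A] by (simp add: CW_hom_def)
  define u0 where "u0 = encode (\<lambda>x. exp (x 0))"
  have dec: "decode u0 = (\<lambda>x. exp (x 0))"
    unfolding u0_def by (rule decode_encode) simp
  have "u0 = cexp smooth_line (encode (\<lambda>x. x 0))"
    unfolding u0_def cexp_def op_smooth_line by simp
  then have "u0 \<in> expset smooth_line"
    unfolding expset_def carrier_smooth_line by auto
  then have u0: "u0 \<in> cunits smooth_line"
    using expset_subset_cunits[OF cinf_ring_smooth_line] by blast
  have step: "pi0_eq (smooth_line, u0) (A, cexp A c)" if "c \<in> carrier_of A" for c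
    using pi0_step[OF L[OF that] u0] by (simp add: dec cexp_def)
  have one: "cexp A (czero A) = cone A"
  proof -
    have "op_of A 0 (\<lambda>y. exp 0) (\<lambda>_. undefined) = cexp A (czero A)"
      unfolding cexp_def czero_def by (rule op_unary[OF A]) auto
    then show ?thesis by (simp add: cone_def)
  qed
  have z: "czero A \<in> carrier_of A"
    using A by (simp add: czero_eq_cscal)
  show ?thesis
  proof
    show "Uplus A \<subseteq> expset A"
    proof
      fix u assume "u \<in> Uplus A"
      then have "pi0_eq (A, u) (A, cone A)" by (simp add: Uplus_def)
      then have "u \<in> expset A \<longleftrightarrow> cone A \<in> expset A"
        using pi0_eq_expset_iff by fastforce
      moreover have "cone A \<in> expset A"
        using one z by (auto simp: expset_def intro: rev_image_eqI)
      ultimately show "u \<in> expset A" by simp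
    qed
    show "expset A \<subseteq> Uplus A"
    proof
      fix u assume u: "u \<in> expset A"
      then obtain c where c: "c \<in> carrier_of A" "u = cexp A c"
        by (auto simp: expset_def)
      have "pi0_eq (A, u) (A, cone A)"
        using pi0_trans[OF pi0_sym[OF step[OF c(1)]] step[OF z]] c one by simp
      then show "u \<in> Uplus A"
        using u expset_subset_cunits[OF A] by (auto simp: Uplus_def)
    qed
  qed
qed

section \<open>Comparison of the two subobjects\<close>

lemma op_real_line:
  assumes A: "cinf_ring A" and f: "f \<in> smooth_fun 1" and g: "g \<in> smooth_fun n"
    and xs: "\<forall>i<n. xs i \<in> carrier_of A"
  shows "op_of A 1 f (\<lambda>_. op_of A n g xs) = op_of A n (\<lambda>y. f (\<lambda>_. g y)) xs"
  using op_compose[OF A f, of "\<lambda>_. g" n xs] g xs by simp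

text \<open>Nilpotency of the ideal is specialised to a product of \<open>k\<close> equal
  factors.\<close>

lemma weil_algebra_decomposition:
  assumes "weil_algebra W" "w \<in> carrier_of W"
  obtains c n k where "n \<in> carrier_of W" "w = cadd W (cscal W c) n"
    "op_of W k (\<lambda>y. \<Prod>i<k. y i) (\<lambda>_. n) = czero W"
proof -
  from assms(1) obtain N k where N: "N \<subseteq> carrier_of W"
    and k: "\<forall>xs. (\<forall>i<k. xs i \<in> N) \<longrightarrow> op_of W k (\<lambda>y. \<Prod>i<k. y i) xs = czero W"
    and dec: "\<forall>w\<in>carrier_of W. \<exists>!(c, n). n \<in> N \<and> w = cadd W (cscal W c) n"
    unfolding weil_algebra_def by (elim conjE exE) (rule that)
  from bspec[OF dec assms(2)] obtain p where "case p of (c, n) \<Rightarrow> n \<in> N \<and> w = cadd W (cscal W c) n"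
    by (elim ex1E)
  then show ?thesis
    using N k by (cases p) (auto intro!: that)
qed

lemma op_flat_at_weil_point:
  assumes W: "cinf_ring W" and n: "n \<in> carrier_of W" and l: "l \<in> carrier_of W"
    and nil: "op_of W 1 (\<lambda>y. y 0 ^ k) (\<lambda>_. n) = czero W"
    and decomp: "l = cadd W (cscal W c) n"
    and pos: "\<And>r. r > 0 \<Longrightarrow> cadd W l (cscal W r) \<in> expset W"
    and f: "f \<in> smooth_fun 1" "\<And>t. t 0 \<ge> 0 \<Longrightarrow> f t = 0"
  shows "op_of W 1 f (\<lambda>_. l) = czero W"
proof -
  have add: "cadd W (cscal W r) s = op_of W 1 (\<lambda>y. r + y 0) (\<lambda>_. s)" if "s \<in> carrier_of W" for r s
    using that op_add[OF W smooth_const smooth_coord, of 0 1 "\<lambda>_. s" r]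
      op_const[OF W, of 1 "\<lambda>_. s" r] op_coord[OF W, of 0 1 "\<lambda>_. s"] by simp
  have zero: "op_of W 1 F (\<lambda>_. s) = czero W"
    if "s \<in> carrier_of W" "P \<in> smooth_fun 1" "K \<in> smooth_fun 1"
      "op_of W 1 P (\<lambda>_. s) = czero W" "\<And>y. F y = P y * K y" for s F P K
  proof -
    have "op_of W 1 F (\<lambda>_. s) = op_of W 1 (\<lambda>_. 0) (\<lambda>_. s)"
      using that by (intro op_eq_if_diff_multiple[OF W, where P = P and K = K]) auto
    then show ?thesis
      using that(1) op_const[OF W, of 1 "\<lambda>_. s" 0] by (simp add: czero_eq_cscal)
  qed
  show ?thesis
  proof (cases "c \<ge> 0")
    case True
    \<comment> \<open>Translation by the real part \<open>c\<close> moves the evaluation from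
      \<open>l\<close> to its nilpotent part; since \<open>c \<ge> 0\<close>, the translate still
      vanishes on the half-line.\<close>
    define \<phi> where "\<phi> t = f (\<lambda>_. c + t)" for t
    have s\<phi>: "(\<lambda>x. \<phi> (x 0)) \<in> smooth_fun 1"
      unfolding \<phi>_def by (rule smooth_compose[OF f(1)]) auto
    with True f(2) have "\<phi> \<in> flat"
      by (auto simp: flat_def \<phi>_def)
    then have K: "(\<lambda>x. \<phi> (x 0) / x 0 ^ k) \<in> smooth_fun 1"
      using flat_divide_power[of \<phi> k] by (simp add: flat_def)
    have "\<phi> 0 = 0"
      using \<open>\<phi> \<in> flat\<close> by (simp add: flat_def)
    then have "\<phi> t = t ^ k * (\<phi> t / t ^ k)" for t
      by (cases "t = 0") auto
    then have "op_of W 1 (\<lambda>x. \<phi> (x 0)) (\<lambda>_. n) = czero W"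
      by (intro zero[OF n _ K nil]) auto
    then show ?thesis
      using op_real_line[OF W f(1), of "\<lambda>y. c + y 0" 1 "\<lambda>_. n"] n
      by (simp add: decomp add \<phi>_def)
  next
    case False
    \<comment> \<open>Choosing \<open>r = - c\<close> cancels the real part, so the nilpotent
      \<open>n\<close> itself is an exponential.\<close>
    then have "cadd W l (cscal W (- c)) \<in> expset W"
      by (intro pos) simp
    also have "cadd W l (cscal W (- c)) = op_of W 1 (\<lambda>y. (c + y 0) + (- c)) (\<lambda>_. n)"
      using n op_add[OF W, of "\<lambda>y. c + y 0" 1 "\<lambda>_. - c" "\<lambda>_. n"] op_const[OF W, of 1 "\<lambda>_. n" "- c"]
      by (simp add: decomp add)
    also have "\<dots> = n"
      using n op_coord[OF W, of 0 1 "\<lambda>_. n"] by simp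
    finally obtain s where s: "s \<in> carrier_of W" "n = cexp W s"
      by (auto simp: expset_def)
    have P: "op_of W 1 (\<lambda>y. exp (y 0) ^ k) (\<lambda>_. s) = czero W"
      using op_real_line[OF W, of "\<lambda>y. y 0 ^ k" "\<lambda>y. exp (y 0)" 1 "\<lambda>_. s"] s nil
      by (simp add: cexp_def)
    have sf: "(\<lambda>y. f (\<lambda>_. c + exp (y 0))) \<in> smooth_fun 1"
      by (rule smooth_compose[OF f(1)]) auto
    \<comment> \<open>Every function is a multiple of the unit \<open>exp (y 0) ^ k\<close>, whose
      value at \<open>s\<close> is \<open>n ^ k = 0\<close>.\<close>
    have "op_of W 1 (\<lambda>y. f (\<lambda>_. c + exp (y 0))) (\<lambda>_. s) = czero W"
    proof (rule zero[OF s(1) _ _ P])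
      show "(\<lambda>y. f (\<lambda>_. c + exp (y 0)) * exp (- y 0) ^ k) \<in> smooth_fun 1"
        by (intro smooth_mult[OF sf] smooth_power smooth_exp smooth_uminus smooth_coord) simp
      show "f (\<lambda>_. c + exp (y 0)) = exp (y 0) ^ k * (f (\<lambda>_. c + exp (y 0)) * exp (- y 0) ^ k)"
        for y :: "nat \<Rightarrow> real"
        by (simp add: exp_minus power_inverse)
    qed (intro smooth_power smooth_exp smooth_coord; simp)
    moreover have "l = op_of W 1 (\<lambda>y. c + exp (y 0)) (\<lambda>_. s)"
      using op_real_line[OF W, of "\<lambda>y. c + y 0" "\<lambda>y. exp (y 0)" 1 "\<lambda>_. s"] s
        expset_subset_carrier[OF W] n by (simp add: decomp add) (simp add: cexp_def)
    ultimately show ?thesis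
      using op_real_line[OF W f(1), of "\<lambda>y. c + exp (y 0)" 1 "\<lambda>_. s"] s by simp
  qed
qed

lemma cone_in_expset: "cinf_ring A \<Longrightarrow> cone A \<in> expset A"
  unfolding cone_def by (rule op_in_expset) auto

lemma AsetD:
  "a \<in> Aset A \<Longrightarrow> CW_hom A B h \<Longrightarrow> u \<in> Uplus B \<Longrightarrow> cadd B (h a) u \<in> Uplus B"
  unfolding Aset_def by blast

lemma MsetD:
  "l \<in> Mset A \<Longrightarrow> CW_hom A B h \<Longrightarrow> a \<in> Aset B \<Longrightarrow> cmul B (h l) a \<in> Aset B"
  unfolding Mset_def by blast

lemma cone_in_Aset:
  assumes "CW_obj A" shows "cone A \<in> Aset A"
  unfolding Aset_def
proof (intro CollectI conjI allI impI ballI)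
  show "cone A \<in> carrier_of A"
    using CW_objD(1)[OF assms] by (simp add: cone_eq_cscal)
next
  fix B h u assume h: "CW_hom A B h" and u: "u \<in> Uplus B"
  then have B: "CW_obj B" and h': "cinf_hom A B h" by (auto simp: CW_hom_def)
  note B' = CW_objD(1)[OF B]
  show "cadd B (h (cone A)) u \<in> Uplus B"
    using u cadd_in_expset[OF B' cone_in_expset[OF B']]
    by (simp add: cone_eq_cscal hom_cscal[OF h' B'] Uplus_eq_expset[OF B])
qed

lemma CW_hom_ident: "CW_obj A \<Longrightarrow> CW_hom A A (\<lambda>x. x)"
  by (simp add: CW_hom_def cinf_hom_def comp_def)

lemma Mset_subset_Hset:
  assumes A: "CW_obj A" shows "Mset A \<subseteq> Hset A"
proof
  note A' = CW_objD(1)[OF A]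
  fix l assume l: "l \<in> Mset A"
  then have lc: "l \<in> carrier_of A" by (simp add: Mset_def)
  have "cmul A l (cone A) \<in> Aset A"
    using MsetD[OF l CW_hom_ident[OF A] cone_in_Aset[OF A]] .
  then have "l \<in> Aset A"
    by (simp add: cmul_cone[OF A' lc])
  then have pos: "cadd A l u \<in> expset A" if "u \<in> expset A" for u
    using that AsetD[OF _ CW_hom_ident[OF A]] by (simp add: Uplus_eq_expset[OF A])
  show "l \<in> Hset A"
    unfolding Hset_def
  proof (intro CollectI conjI ballI impI)
    fix f assume f: "f \<in> smooth_fun 1" and f0: "\<forall>t. t 0 \<ge> 0 \<longrightarrow> f t = 0"
    \<comment> \<open>Since \<open>A\<close> is W-determined, the equation may be tested after every
      homomorphism to a Weil algebra.\<close>
    have eq: "h (op_of A 1 f (\<lambda>_. l)) = h (czero A)"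
      if Wa: "weil_algebra W" and h: "cinf_hom A W h" for W :: obj and h
    proof -
      have W: "cinf_ring W"
        using Wa by (simp add: weil_algebra_def)
      have hl: "h l \<in> carrier_of W"
        using hom_closed[OF h lc] .
      obtain c n k where nc: "n \<in> carrier_of W" and n: "h l = cadd W (cscal W c) n"
        and k: "op_of W k (\<lambda>y. \<Prod>i<k. y i) (\<lambda>_. n) = czero W"
        using weil_algebra_decomposition[OF Wa hl] .
      \<comment> \<open>Substitution along the diagonal turns the product of \<open>k\<close>
        variables into a power of one variable.\<close>
      have "op_of W 1 (\<lambda>y. \<Prod>i<k. y 0) (\<lambda>_. n) = op_of W k (\<lambda>y. \<Prod>i<k. y i) (\<lambda>_. op_of W 1 (\<lambda>y. y 0) (\<lambda>_. n))"
        using nc by (intro op_compose[OF W smooth_prod]) auto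
      also have "\<dots> = czero W"
        using k op_coord[OF W, of 0 1 "\<lambda>_. n"] nc by simp
      finally have nil: "op_of W 1 (\<lambda>y. y 0 ^ k) (\<lambda>_. n) = czero W"
        by simp
      have "cadd W (h l) (cscal W r) \<in> expset W" if "r > 0" for r
      proof -
        have "cscal A r \<in> expset A"
          unfolding cscal_def using that by (intro op_in_expset[OF A']) auto
        then have "h (cadd A l (cscal A r)) \<in> expset W"
          by (intro hom_expset[OF h] pos)
        then show ?thesis
          by (simp add: hom_cadd[OF h W lc cscal_closed[OF A']] hom_cscal[OF h W])
      qed
      then have "op_of W 1 f (\<lambda>_. h l) = czero W"
        using f0 by (intro op_flat_at_weil_point[OF W nc hl nil n _ f]) auto
      then show ?thesis
        using lc f by (simp add: hom_op[OF h] czero_eq_cscal hom_cscal[OF h W])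
    qed
    have c: "op_of A 1 f (\<lambda>_. l) \<in> carrier_of A" "czero A \<in> carrier_of A"
      using lc f A' by (auto simp: czero_eq_cscal intro!: op_closed)
    show "op_of A 1 f (\<lambda>_. l) = czero A"
      by (rule CW_objD(2)[OF A, unfolded W_determined_def, rule_format, OF c]) (use eq in blast)
  qed (rule lc)
qed

section \<open>From \<open>H\<close> to \<open>M\<close>: a positive factorisation\<close>

lemma hom_Hset:
  assumes "cinf_hom A B h" "cinf_ring B" "l \<in> Hset A"
  shows "h l \<in> Hset B"
  unfolding Hset_def
proof (intro CollectI conjI ballI impI)
  have l: "l \<in> carrier_of A" using assms(3) by (simp add: Hset_def)
  then show "h l \<in> carrier_of B" by (rule hom_closed[OF assms(1)])
  fix f assume f: "f \<in> smooth_fun 1" "\<forall>t. t 0 \<ge> 0 \<longrightarrow> f t = 0"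
  then have "op_of A 1 f (\<lambda>_. l) = czero A"
    using assms(3) by (auto simp: Hset_def)
  then have "h (op_of A 1 f (\<lambda>_. l)) = czero B"
    by (simp add: czero_eq_cscal hom_cscal[OF assms(1,2)])
  then show "op_of B 1 f (\<lambda>_. h l) = czero B"
    using f l by (simp add: hom_op[OF assms(1)])
qed

text \<open>For \<open>s > - \<epsilon>\<close> the first two terms suffice. For
  \<open>s \<le> - \<epsilon>\<close> the factor \<open>exp (1 / \<epsilon>)\<close> compensates
  \<open>exp (1 / s)\<close>, so the correction is at least \<open>1 + s\<^sup>2\<close>, which
  exceeds \<open>- s\<close>.\<close>

lemma exp_flat_correction_pos:
  fixes s \<epsilon> :: real
  assumes "\<epsilon> > 0"
  shows "s + \<epsilon> + exp_flat s * ((1 + s\<^sup>2) * exp (1 / \<epsilon>)) > 0"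
proof -
  consider "s + \<epsilon> > 0" | "s \<le> - \<epsilon>" by linarith
  then show ?thesis
  proof cases
    case 1
    moreover have "exp_flat s * ((1 + s\<^sup>2) * exp (1 / \<epsilon>)) \<ge> 0"
      by (simp add: exp_flat_def)
    ultimately show ?thesis by linarith
  next
    case 2
    with assms have s: "s < 0" by simp
    have "1 / s \<ge> - (1 / \<epsilon>)"
      using 2 s assms by (simp add: field_simps)
    then have "exp (1 / s) * exp (1 / \<epsilon>) \<ge> 1"
      by (simp flip: exp_add)
    then have "exp_flat s * ((1 + s\<^sup>2) * exp (1 / \<epsilon>)) \<ge> 1 + s\<^sup>2"
      using s mult_left_mono[of 1 "exp (1 / s) * exp (1 / \<epsilon>)" "1 + s\<^sup>2"]
      by (simp add: exp_flat_def mult_ac)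
    moreover have "s + (1 + s\<^sup>2) > 0"
    proof -
      have "(s + 1 / 2)\<^sup>2 \<ge> 0" by simp
      then show ?thesis by (simp add: power2_eq_square algebra_simps)
    qed
    ultimately show ?thesis using assms by linarith
  qed
qed

text \<open>Expanding \<open>D * (a + \<delta> / D)\<close> gives \<open>D * a + \<delta>\<close>.
  Modulo the flat function \<open>D\<close> is \<open>y + \<epsilon>\<close>, and the two terms
  \<open>\<epsilon> * a\<close> cancel. The second factor is positive by \<open>pos\<close> applied
  to the exponential \<open>\<delta> / D\<close>.\<close>

lemma Hset_mult_add_in_expset:
  assumes C: "cinf_ring C" and y: "y \<in> Hset C" and a: "a \<in> carrier_of C"
    and pos: "\<And>u. u \<in> expset C \<Longrightarrow> cadd C a u \<in> expset C"
    and u: "u \<in> expset C"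
  shows "cadd C (cmul C y a) u \<in> expset C"
proof -
  obtain t where t: "t \<in> carrier_of C" "u = cexp C t"
    using u by (auto simp: expset_def)
  have yc: "y \<in> carrier_of C" using y by (simp add: Hset_def)
  \<comment> \<open>Coordinates \<open>0\<close>, \<open>1\<close>, \<open>2\<close> stand for
    \<open>y\<close>, \<open>a\<close> and the logarithm \<open>t\<close> of
    \<open>u\<close>.\<close>
  let ?xs = "(!) [y, a, t]"
  have xs: "\<forall>i<3. ?xs i \<in> carrier_of C"
    using yc a t by (auto simp: less_Suc_eq numeral_3_eq_3)
  have xs0: "op_of C 3 (\<lambda>x. x 0) ?xs = y" and xs1: "op_of C 3 (\<lambda>x. x 1) ?xs = a"
    and xs2: "op_of C 3 (\<lambda>x. x 2) ?xs = t"
    using op_coord[OF C _ xs] by force+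
  have xsexp: "op_of C 3 (\<lambda>x. exp (x 2)) ?xs = u"
    using op_unary[OF C _ _ xs, of exp "\<lambda>x. x 2"] xs2 t by (simp add: cexp_def)
  \<comment> \<open>A polynomial bound for \<open>x 1\<close>: it keeps
    \<open>\<epsilon> x * x 1\<close> below \<open>exp (x 2)\<close>, hence \<open>\<delta>\<close>
    positive, while \<open>\<epsilon>\<close> stays smooth and positive.\<close>
  define q :: "(nat \<Rightarrow> real) \<Rightarrow> real" where "q x = 2 * (1 + (x 1)\<^sup>2)" for x
  define \<epsilon> where "\<epsilon> x = exp (x 2) / q x" for x :: "nat \<Rightarrow> real"
  define K where "K x = (1 + (x 0)\<^sup>2) * exp (1 / \<epsilon> x)" for x
  define D where "D x = x 0 + \<epsilon> x + exp_flat (x 0) * K x" for x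
  define \<delta> where "\<delta> x = exp (x 2) - \<epsilon> x * x 1" for x
  have q: "q x > 0" for x
    unfolding q_def by (intro mult_pos_pos add_pos_nonneg) auto
  then have \<epsilon>: "\<epsilon> x > 0" for x
    by (simp add: \<epsilon>_def)
  have D: "D x > 0" for x
    unfolding D_def K_def by (rule exp_flat_correction_pos[OF \<epsilon>])
  have \<delta>: "\<delta> x > 0" for x
  proof -
    \<comment> \<open>This sum of squares certifies
      \<open>2 * q x - 2 * x 1 \<ge> 3\<close>.\<close>
    have "0 \<le> (x 1 - 1)\<^sup>2 + 3 * (x 1)\<^sup>2" by simp
    also have "\<dots> = 2 * q x - 2 * x 1 - 3"
      by (simp add: q_def power2_eq_square algebra_simps)
    finally have "x 1 < q x" by simp
    then have "x 1 / q x < 1"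
      using q[of x] by simp
    then have "exp (x 2) * (x 1 / q x) < exp (x 2) * 1"
      by (intro mult_strict_left_mono) auto
    then show ?thesis
      by (simp add: \<delta>_def \<epsilon>_def)
  qed
  have coord: "(\<lambda>x. x i) \<in> smooth_fun 3" if "i < 3" for i
    using that by (rule smooth_coord)
  have sq: "q \<in> smooth_fun 3"
    unfolding q_def [abs_def] by (intro smooth_mult smooth_add smooth_power coord smooth_const) simp
  have s\<epsilon>: "\<epsilon> \<in> smooth_fun 3"
    unfolding \<epsilon>_def [abs_def] by (intro smooth_divide smooth_exp coord sq q) simp
  have sK: "K \<in> smooth_fun 3"
    unfolding K_def [abs_def]
    by (intro smooth_mult smooth_add smooth_power smooth_exp smooth_divide coord smooth_const s\<epsilon> \<epsilon>) simp
  have se: "(\<lambda>x. exp_flat (x 0)) \<in> smooth_fun 3"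
    by (rule smooth_univariate_compose[OF smooth_exp_flat coord]) simp
  have sD: "D \<in> smooth_fun 3"
    unfolding D_def [abs_def] by (intro smooth_mult smooth_add se sK s\<epsilon> coord) simp
  have s\<delta>: "\<delta> \<in> smooth_fun 3"
    unfolding \<delta>_def [abs_def] by (intro smooth_mult smooth_diff smooth_exp s\<epsilon> coord) simp_all
  have sz: "(\<lambda>x. \<delta> x / D x) \<in> smooth_fun 3"
    by (intro smooth_divide s\<delta> sD D)
  \<comment> \<open>Here \<open>y \<in> Hset C\<close> does its work: the flat function vanishes at
    \<open>y\<close>.\<close>
  have flat0: "op_of C 3 (\<lambda>x. exp_flat (x 0)) ?xs = czero C"
  proof -
    have "op_of C 3 (\<lambda>x. exp_flat (x 0)) ?xs = op_of C 1 (\<lambda>x. exp_flat (x 0)) (\<lambda>_. y)"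
      using op_unary[OF C smooth_exp_flat coord xs, of 0] xs0 by simp
    also have "\<dots> = czero C"
      using y smooth_exp_flat by (auto simp: Hset_def exp_flat_def)
    finally show ?thesis .
  qed
  have "cadd C a (op_of C 3 (\<lambda>x. \<delta> x / D x) ?xs) \<in> expset C"
    using \<delta> D by (intro pos op_in_expset[OF C sz _ xs]) simp
  then have "cmul C (op_of C 3 D ?xs) (cadd C a (op_of C 3 (\<lambda>x. \<delta> x / D x) ?xs)) \<in> expset C"
    by (intro cmul_in_expset[OF C] op_in_expset[OF C sD D xs])
  also have "cmul C (op_of C 3 D ?xs) (cadd C a (op_of C 3 (\<lambda>x. \<delta> x / D x) ?xs)) =
      op_of C 3 (\<lambda>x. D x * (x 1 + \<delta> x / D x)) ?xs"
    using op_mult[OF C sD smooth_add[OF coord sz] xs, of 1] op_add[OF C coord sz xs, of 1] xs1 by simp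
  also have "\<dots> = op_of C 3 (\<lambda>x. x 0 * x 1 + exp (x 2)) ?xs"
  proof (rule op_eq_if_diff_multiple[OF C xs _ se _ flat0])
    show "(\<lambda>x. K x * x 1) \<in> smooth_fun 3"
      by (intro smooth_mult sK coord) simp
    show "(\<lambda>x. x 0 * x 1 + exp (x 2)) \<in> smooth_fun 3"
      by (intro smooth_mult smooth_add smooth_exp coord) simp_all
    fix x
    have "D x * (x 1 + \<delta> x / D x) = D x * x 1 + \<delta> x"
      using D[of x] by (simp add: field_simps)
    then show "D x * (x 1 + \<delta> x / D x) = x 0 * x 1 + exp (x 2) + exp_flat (x 0) * (K x * x 1)"
      by (simp add: D_def \<delta>_def algebra_simps)
  qed
  also have "\<dots> = cadd C (cmul C y a) u"
    using op_add[OF C smooth_mult[OF coord coord] smooth_exp[OF coord] xs, of 0 1 2]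
      op_mult[OF C coord coord xs, of 0 1] xs0 xs1 xsexp by simp
  finally show ?thesis .
qed

text \<open>Unfolding \<open>M\<close> and then \<open>A\<close> introduces two successive stages
  \<open>B\<close> and \<open>C\<close>. Both \<open>Hset\<close> and the condition on
  \<open>a\<close> pass to \<open>C\<close>, where the factorisation applies.\<close>

lemma Hset_subset_Mset:
  assumes A: "CW_obj A" shows "Hset A \<subseteq> Mset A"
proof
  fix l assume l: "l \<in> Hset A"
  show "l \<in> Mset A"
    unfolding Mset_def
  proof (intro CollectI conjI allI impI ballI)
    show "l \<in> carrier_of A" using l by (simp add: Hset_def)
    fix B h a assume h: "CW_hom A B h" and a: "a \<in> Aset B"
    then have B: "CW_obj B" and h': "cinf_hom A B h" by (auto simp: CW_hom_def)
    note B' = CW_objD(1)[OF B]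
    have hl: "h l \<in> Hset B" by (rule hom_Hset[OF h' B' l])
    then have hlc: "h l \<in> carrier_of B" by (simp add: Hset_def)
    have ac: "a \<in> carrier_of B" using a by (simp add: Aset_def)
    show "cmul B (h l) a \<in> Aset B"
      unfolding Aset_def
    proof (intro CollectI conjI allI impI ballI)
      show "cmul B (h l) a \<in> carrier_of B" by (rule cmul_closed[OF B' hlc ac])
      fix C k u assume k: "CW_hom B C k" and u: "u \<in> Uplus C"
      then have C: "CW_obj C" and k': "cinf_hom B C k" by (auto simp: CW_hom_def)
      note C' = CW_objD(1)[OF C]
      have pos: "cadd C (k a) u \<in> expset C" if "u \<in> expset C" for u
        using that AsetD[OF a k] by (simp add: Uplus_eq_expset[OF C])
      show "cadd C (k (cmul B (h l) a)) u \<in> Uplus C"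
        using Hset_mult_add_in_expset[OF C' hom_Hset[OF k' C' hl] hom_closed[OF k' ac] pos] u
        by (simp add: hom_cmul[OF k' C' hlc ac] Uplus_eq_expset[OF C])
    qed
  qed
qed

theorem theorem5p6:
  shows "\<forall>A. CW_obj A \<longrightarrow> Mset A = Hset A"
  using Mset_subset_Hset Hset_subset_Mset by blast

end
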